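(* Let $\tilde f:\mathbb{CP}^3\to\mathbb{CP}^3$ be a holomorphic endomorphism, and let $f$ be the induced map on holomorphically embedded null curves $\chi:\mathbb{C}\to M$ in $M=\mathbb{C}^4$ given by $f\circ\chi=\kappa^{-1}\circ\tilde f\circ\kappa\circ\chi$. Then the map $f\circ\chi$ gives rise to a holomorphic endomorphism $f_1:\mathcal F\to\mathcal F$ of the twistor correspondence space $\mathcal F$ of $M$, and therefore defines a self-dual morphism of $M$.
   Context: **Spacetime and spinors.** $M=\mathbb{C}^4$ is complexified Minkowski space. Its points are written as complex $2\times 2$ matrices $x=(x^{AA'})$, and a tangent vector $v^{AA'}$ is null iff $\det v=0$. Primed spinors $\pi_{A'}$ have two complex components, and their indices are raised and lowered with the antisymmetric $\varepsilon$. **Null curves.** A null curve is a nonsingular holomorphic embedding $\chi:\mathbb{C}\to M$, $s\mapsto\chi(s)$, whose derivative $\dot\chi$ is a nonzero null vector. **Twistor space.** The twistor space of $M$ is $\mathbb{CP}^3$, with homogeneous coordinates $z=(\omega^A,\pi_{A'})$. (More precisely it is $\mathbb{CP}^3-\mathbb{CP}^1$ for non-compact $M$. This distinction is disregarded, the constructions being regarded as valid also for compactified $M$.) The point $z$ represents the $\alpha$-plane of points $x$ with $\omega^A=i x^{AA'}\pi_{A'}$, whose tangent vectors are the $v$ with $v^{AA'}\pi_{A'}=0$. **The map $\kappa$.** For a null curve $\chi$, $z=\kappa\circ\chi:\mathbb{C}\to\mathbb{CP}^3$ sends $s$ to the unique $\alpha$-plane that passes through $\chi(s)$ and contains $\dot\chi(s)$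 in its tangent space: $\omega^A=i\chi^{AA'}\pi_{A'}$ and $\dot\chi^{AA'}\pi_{A'}=0$. **The map $\kappa^{-1}$.** For a given curve $z(s)=(\omega^A(s),\pi_{A'}(s))$ in $\mathbb{CP}^3$, in a non-singular region, the null curve $\chi=\kappa^{-1}\circ z$ is given by $$i\chi^{AA'}=\frac{\omega^A\dot\pi^{A'}-\dot\omega^A\pi^{A'}}{\pi_{C'}\dot\pi^{C'}}.$$ **Endomorphisms of $\mathbb{CP}^3$.** A holomorphic endomorphism $\tilde f$ of $\mathbb{CP}^3$ is given by a polynomial self-map $F=(F_0,\dots,F_3)$ of $\mathbb{C}^4$ with $F^{-1}(0)=\{0\}$ whose components are homogeneous polynomials of the same degree $d\ge1$. **Twistor correspondence space.** $(\mathcal F,p,M)$ is the bundle over $M$, with projection $p$, whose fiber at $x\in M$ is the set of $\alpha$-planes passing through $x$, parametrized by a projective primed spinor $\pi_{A'}$ at $x$. Its points are written $(x,\pi)$. **How $f$ gives rise to $f_1$.** If $\chi$ is a null curve tangent at $\chi(s)$ to the $\alpha$-plane $z=(\omega^A,\pi_{A'})$, put $\xi=f\circ\chi$ and let $\tilde\pi$ be the primed spinor part of $\tilde f(z)$. Then $f_1(\chi,\pi)=(\xi,\tilde\pi)$, where $\xi$ and $\tilde\pi$ depend only on the point $(\chi,\pi)\in\mathcal F$ and not on the choice of curve tangent to that $\alpha$-plane there. **Self-dual morphisms.** A self-dual surface is a holomorphically embedded two-surface in $M$ whose tangent plane at each point is an $\alpha$-plane; it lifts to $\mathcal F$ by attaching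 to each point its tangent $\alpha$-plane. A self-dual morphism of $M$ is a map on nonsingular self-dual surfaces in $M$ that is local (if two self-dual surfaces share a tangent $\alpha$-plane at given points, then so do their images at those points) and holomorphically varying. These maps can be characterized by holomorphic endomorphisms $f_1:\mathcal F\to\mathcal F$ satisfying the tangent consistency condition: for every self-dual surface, applying $f_1$ to its lift and projecting by $p$ gives the image surface, and the $\alpha$-plane component of $f_1$ along the lift is the tangent $\alpha$-plane of that image surface.
   Formalization: f_1 is defined and holomorphic only on the open dense set of (x,π) where κ^{-1}∘f̃∘κ is nonsingular (swapping ω and π gives x↦-x^{-1}, undefined at det x=0); the self-dual morphism acts on surfaces lifting to the open dense part where also dF is injective, since others collapse. *)

theory Defs
  imports "HOL-Complex_Analysis.Complex_Analysis"
begin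

section \<open>Holomorphic maps in several variables\<close>

class complex_space = real_normed_vector +
  fixes scaleC :: "complex \<Rightarrow> 'a \<Rightarrow> 'a"  (infixr \<open>*\<^sub>C\<close> 75)
  assumes scaleC_add_right: "c *\<^sub>C (x + y) = c *\<^sub>C x + c *\<^sub>C y"
    and scaleC_add_left: "(c + d) *\<^sub>C x = c *\<^sub>C x + d *\<^sub>C x"
    and scaleC_scaleC: "c *\<^sub>C d *\<^sub>C x = (c * d) *\<^sub>C x"
    and scaleC_of_real: "complex_of_real r *\<^sub>C x = r *\<^sub>R x"

instantiation complex :: complex_space
begin
definition scaleC_complex_def: "c *\<^sub>C (x::complex) = c * x"
instance
  by standard (simp_all add: scaleC_complex_def algebra_simps scaleR_conv_of_real)
end

instantiation vec :: (complex_space, finite) complex_space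
begin
definition scaleC_vec_def: "c *\<^sub>C x = (\<chi> i. c *\<^sub>C (x $ i))"
instance
  by standard (simp_all add: scaleC_vec_def vec_eq_iff scaleC_add_right scaleC_add_left
      scaleC_scaleC scaleC_of_real)
end

instantiation prod :: (complex_space, complex_space) complex_space
begin
definition scaleC_prod_def: "c *\<^sub>C x = (c *\<^sub>C fst x, c *\<^sub>C snd x)"
instance
  by standard (simp_all add: scaleC_prod_def prod_eq_iff scaleC_add_right scaleC_add_left
      scaleC_scaleC scaleC_of_real)
end

definition holo_on :: "('a::complex_space \<Rightarrow> 'b::complex_space) \<Rightarrow> 'a set \<Rightarrow> bool" where
  "holo_on f U \<longleftrightarrow> open U \<and>
     (\<forall>x\<in>U. \<exists>D. (f has_derivative D) (at x) \<and> (\<forall>c v. D (c *\<^sub>C v) = c *\<^sub>C D v))"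

definition velocity :: "(complex \<Rightarrow> 'a::complex_space) \<Rightarrow> complex \<Rightarrow> 'a" where
  "velocity X s = frechet_derivative X (at s) 1"


section \<open>Complex projective space\<close>

definition proj_rel :: "complex^'n::finite \<Rightarrow> complex^'n \<Rightarrow> bool" where
  "proj_rel v w \<longleftrightarrow> v \<noteq> 0 \<and> w \<noteq> 0 \<and> (\<exists>c. c \<noteq> 0 \<and> w = c *s v)"

quotient_type (overloaded) 'n proj = "complex^'n::finite" / partial: proj_rel
  morphisms rep_proj proj
proof (rule part_equivpI)
  show "\<exists>v::complex^'n. proj_rel v v"
    by (rule exI[of _ "\<chi> i. 1"]) (auto simp: proj_rel_def vec_eq_iff intro!: exI[of _ 1])
  show "symp (proj_rel :: complex^'n \<Rightarrow> _)"
  proof (rule sympI)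
    fix v w :: "complex^'n"
    assume "proj_rel v w"
    then obtain c where c: "v \<noteq> 0" "w \<noteq> 0" "c \<noteq> 0" "w = c *s v"
      unfolding proj_rel_def by blast
    have "inverse c \<noteq> 0" using c(3) by simp
    moreover have "v = inverse c *s w"
      unfolding c(4) vector_smult_assoc using c(3) by simp
    ultimately show "proj_rel w v"
      unfolding proj_rel_def using c(1,2) by blast
  qed
  show "transp (proj_rel :: complex^'n \<Rightarrow> _)"
  proof (rule transpI)
    fix u v w :: "complex^'n"
    assume "proj_rel u v" "proj_rel v w"
    then obtain c d where *: "u \<noteq> 0" "w \<noteq> 0" "c \<noteq> 0" "d \<noteq> 0" "v = c *s u" "w = d *s v"
      unfolding proj_rel_def by blast
    have "d * c \<noteq> 0" using *(3,4) by simp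
    moreover have "w = (d * c) *s u"
      unfolding *(5,6) vector_smult_assoc ..
    ultimately show "proj_rel u w"
      unfolding proj_rel_def using *(1,2) by blast
  qed
qed

text \<open>The quotient topology from the nonzero vectors.\<close>

instantiation proj :: (finite) topological_space
begin
definition open_proj_def: "open (U :: 'a proj set) \<longleftrightarrow> open {v. v \<noteq> 0 \<and> proj v \<in> U}"
instance
proof
  have "{v::complex^'a. v \<noteq> 0 \<and> proj v \<in> UNIV} = - {0}" by auto
  then show "open (UNIV :: 'a proj set)"
    unfolding open_proj_def by (simp only: open_Compl closed_singleton)
next
  fix S T :: "'a proj set"
  assume "open S" "open T"
  moreover have "{v. v \<noteq> 0 \<and> proj v \<in> S \<inter> T} =
      {v. v \<noteq> 0 \<and> proj v \<in> S} \<inter> {v. v \<noteq> 0 \<and> proj v \<in> T}" by auto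
  ultimately show "open (S \<inter> T)"
    unfolding open_proj_def by (simp only: open_Int)
next
  fix K :: "'a proj set set"
  assume "\<forall>S\<in>K. open S"
  moreover have "{v. v \<noteq> 0 \<and> proj v \<in> \<Union>K} = (\<Union>S\<in>K. {v. v \<noteq> 0 \<and> proj v \<in> S})" by auto
  ultimately show "open (\<Union>K)"
    unfolding open_proj_def by (simp only: open_UN ball_simps)
qed
end

definition homogeneous_polynomial :: "nat \<Rightarrow> (complex^'n::finite \<Rightarrow> complex) \<Rightarrow> bool" where
  "homogeneous_polynomial d P \<longleftrightarrow>
     (\<exists>c :: ('n \<Rightarrow> nat) \<Rightarrow> complex.
        \<forall>z. P z = (\<Sum>\<alpha> | sum \<alpha> UNIV = d. c \<alpha> * (\<Prod>j\<in>UNIV. z $ j ^ \<alpha> j)))"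

definition proj_endomorphism ::
  "nat \<Rightarrow> (complex^'n::finite \<Rightarrow> complex^'n) \<Rightarrow> ('n proj \<Rightarrow> 'n proj) \<Rightarrow> bool" where
  "proj_endomorphism d F ft \<longleftrightarrow>
     d \<ge> 1 \<and> (\<forall>i. homogeneous_polynomial d (\<lambda>z. F z $ i)) \<and> F -` {0} = {0} \<and>
     (\<forall>z. z \<noteq> 0 \<longrightarrow> ft (proj z) = proj (F z))"


section \<open>Twistors and null curves\<close>

text \<open>A point or tangent vector \<open>x\<close> has components \<open>x $ A $ A'\<close>, so that
  \<open>x *v p\<close> is the contraction with a primed spinor \<open>p\<close> carrying a lower index. The summand
  \<open>Inl\<close> indexes the \<open>\<omega>\<close> part of a twistor, and \<open>Inr\<close> its primed part.\<close>

type_synonym point = "complex^2^2"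
type_synonym spinor = "complex^2"
type_synonym twistor = "complex^(2 + 2)"
type_synonym CP1 = "2 proj"
type_synonym CP3 = "(2 + 2) proj"

definition omega :: "twistor \<Rightarrow> spinor" where
  "omega z = (\<chi> A. z $ Inl A)"

definition primed :: "twistor \<Rightarrow> spinor" where
  "primed z = (\<chi> A. z $ Inr A)"

definition primed_class :: "CP3 \<Rightarrow> CP1" where
  "primed_class Z = proj (primed (rep_proj Z))"

definition incident :: "point \<Rightarrow> twistor \<Rightarrow> bool" where
  "incident x z \<longleftrightarrow> omega z = \<i> *s (x *v primed z)"

text \<open>Raising with \<open>\<epsilon>\<^sup>1\<^sup>2 = 1\<close>; with the opposite sign \<open>twistor_point\<close> below is unchanged.\<close>

definition raise :: "spinor \<Rightarrow> spinor" where
  "raise p = vector [p $ 2, - (p $ 1)]"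

definition contract :: "spinor \<Rightarrow> spinor \<Rightarrow> complex" where
  "contract p q = (\<Sum>C\<in>UNIV. p $ C * raise q $ C)"

definition null_curve :: "(complex \<Rightarrow> point) \<Rightarrow> bool" where
  "null_curve X \<longleftrightarrow> holo_on X UNIV \<and> (\<exists>g. homeomorphism UNIV (range X) X g) \<and>
     (\<forall>s. velocity X s \<noteq> 0 \<and> det (velocity X s) = 0)"

definition kappa :: "(complex \<Rightarrow> point) \<Rightarrow> complex \<Rightarrow> CP3" where
  "kappa X s = (THE Z. \<exists>z. z \<noteq> 0 \<and> Z = proj z \<and> incident (X s) z \<and>
                          velocity X s *v primed z = 0)"

definition curve_lift :: "(complex \<Rightarrow> 'n::finite proj) \<Rightarrow> complex set \<Rightarrow>
    (complex \<Rightarrow> complex^'n) \<Rightarrow> bool" where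
  "curve_lift Z U z \<longleftrightarrow> holo_on z U \<and> (\<forall>t\<in>U. z t \<noteq> 0 \<and> Z t = proj (z t))"

definition twistor_point :: "twistor \<Rightarrow> twistor \<Rightarrow> point" where
  "twistor_point z z' = (\<chi> A A'.
     (omega z $ A * raise (primed z') $ A' - omega z' $ A * raise (primed z) $ A')
       / contract (primed z) (primed z') / \<i>)"

text \<open>The inverse of \<open>kappa\<close> is computed in homogeneous coordinates; neither its value nor
  the nonsingularity condition depends on the chosen local lift.\<close>

definition nonsingular_at :: "(complex \<Rightarrow> CP3) \<Rightarrow> complex \<Rightarrow> bool" where
  "nonsingular_at Z s \<longleftrightarrow>
     (\<exists>U z. s \<in> U \<and> curve_lift Z U z \<and> contract (primed (z s)) (primed (velocity z s)) \<noteq> 0)"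

definition kappa_inv :: "(complex \<Rightarrow> CP3) \<Rightarrow> complex \<Rightarrow> point" where
  "kappa_inv Z s = (THE x. \<exists>U z. s \<in> U \<and> curve_lift Z U z \<and>
      contract (primed (z s)) (primed (velocity z s)) \<noteq> 0 \<and>
      x = twistor_point (z s) (velocity z s))"

definition induced :: "(CP3 \<Rightarrow> CP3) \<Rightarrow> (complex \<Rightarrow> point) \<Rightarrow> complex \<Rightarrow> point" where
  "induced ft X = kappa_inv (ft \<circ> kappa X)"


section \<open>The correspondence space\<close>

type_synonym corr = "point \<times> CP1"

text \<open>Holomorphy is tested on local lifts to homogeneous coordinates, the projection
  \<open>proj\<close> from the nonzero spinors being a holomorphic submersion.\<close>

definition corr_holo_on :: "(corr \<Rightarrow> corr) \<Rightarrow> corr set \<Rightarrow> bool" where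
  "corr_holo_on g W \<longleftrightarrow> open W \<and>
     (\<forall>x p. p \<noteq> 0 \<and> (x, proj p) \<in> W \<longrightarrow>
        (\<exists>V h. (x, p) \<in> V \<and> holo_on h V \<and>
           (\<forall>(y, q)\<in>V. q \<noteq> 0 \<and> (y, proj q) \<in> W \<and> snd (h (y, q)) \<noteq> 0 \<and>
               g (y, proj q) = (fst (h (y, q)), proj (snd (h (y, q)))))))"

text \<open>The formula for \<open>kappa_inv\<close> has poles, so a map of null curves induces a map of the
  correspondence space only where some null curve through the given point with the given
  tangent \<open>\<alpha>\<close>-plane has a nonsingular image.\<close>

definition nonsingular_region :: "(CP3 \<Rightarrow> CP3) \<Rightarrow> corr set" where
  "nonsingular_region ft =
     {(X s, primed_class (kappa X s)) | X s. null_curve X \<and> nonsingular_at (ft \<circ> kappa X) s}"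

text \<open>Where the Jacobian of \<open>F\<close> degenerates, an \<open>\<alpha>\<close>-plane is collapsed, so surfaces have
  singular images there.\<close>

definition regular_region :: "(twistor \<Rightarrow> twistor) \<Rightarrow> (CP3 \<Rightarrow> CP3) \<Rightarrow> corr set" where
  "regular_region F ft = nonsingular_region ft \<inter>
     {(x, proj (primed z)) | x z. z \<noteq> 0 \<and> incident x z \<and> inj (frechet_derivative F (at z))}"

definition arises_from :: "(corr \<Rightarrow> corr) \<Rightarrow> (CP3 \<Rightarrow> CP3) \<Rightarrow> bool" where
  "arises_from f1 ft \<longleftrightarrow>
     (\<forall>X s. null_curve X \<and> nonsingular_at (ft \<circ> kappa X) s \<longrightarrow>
        f1 (X s, primed_class (kappa X s)) = (induced ft X s, primed_class (ft (kappa X s))))"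


section \<open>Self-dual surfaces and morphisms\<close>

definition alpha_directions :: "spinor \<Rightarrow> point set" where
  "alpha_directions p = {v. v *v p = 0}"

definition surface_chart :: "point set \<Rightarrow> (complex^2) set \<Rightarrow> (complex^2 \<Rightarrow> point) \<Rightarrow> bool" where
  "surface_chart S U \<sigma> \<longleftrightarrow> holo_on \<sigma> U \<and> (\<forall>u\<in>U. inj (frechet_derivative \<sigma> (at u))) \<and>
     (\<exists>g. homeomorphism U (\<sigma> ` U) \<sigma> g) \<and> (\<exists>W. open W \<and> \<sigma> ` U = S \<inter> W)"

definition embedded_surface :: "point set \<Rightarrow> bool" where
  "embedded_surface S \<longleftrightarrow> S \<noteq> {} \<and> connected S \<and>
     (\<forall>x\<in>S. \<exists>U \<sigma>. surface_chart S U \<sigma> \<and> x \<in> \<sigma> ` U)"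

definition tangent_plane :: "point set \<Rightarrow> point \<Rightarrow> point set" where
  "tangent_plane S x =
     {v. \<exists>U \<sigma> u. surface_chart S U \<sigma> \<and> u \<in> U \<and> \<sigma> u = x \<and> v \<in> range (frechet_derivative \<sigma> (at u))}"

definition self_dual_surface :: "point set \<Rightarrow> bool" where
  "self_dual_surface S \<longleftrightarrow> embedded_surface S \<and>
     (\<forall>x\<in>S. \<exists>p. p \<noteq> 0 \<and> tangent_plane S x = alpha_directions p)"

definition tangent_alpha :: "point set \<Rightarrow> point \<Rightarrow> CP1" where
  "tangent_alpha S x =
     (THE a. \<exists>p. p \<noteq> 0 \<and> a = proj p \<and> tangent_plane S x = alpha_directions p)"

definition surface_lift :: "point set \<Rightarrow> corr set" where
  "surface_lift S = (\<lambda>x. (x, tangent_alpha S x)) ` S"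

definition surface_in :: "corr set \<Rightarrow> point set \<Rightarrow> bool" where
  "surface_in W S \<longleftrightarrow> self_dual_surface S \<and> surface_lift S \<subseteq> W"

text \<open>A map \<open>\<Phi>\<close> on surfaces carries each \<open>x \<in> S\<close> to the point \<open>\<Phi> S x\<close> of the
  image surface \<open>\<Phi> S ` S\<close>. The last two conditions of the next definition are locality and
  holomorphic variation.\<close>

definition self_dual_morphism :: "corr set \<Rightarrow> (point set \<Rightarrow> point \<Rightarrow> point) \<Rightarrow> bool" where
  "self_dual_morphism W \<Phi> \<longleftrightarrow>
     (\<forall>S. surface_in W S \<longrightarrow> self_dual_surface (\<Phi> S ` S)) \<and>
     (\<forall>S T x. surface_in W S \<and> surface_in W T \<and> x \<in> S \<inter> T \<and>
          tangent_alpha S x = tangent_alpha T x \<longrightarrow>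
        \<Phi> S x = \<Phi> T x \<and>
        tangent_alpha (\<Phi> S ` S) (\<Phi> S x) = tangent_alpha (\<Phi> T ` T) (\<Phi> T x)) \<and>
     (\<exists>g. corr_holo_on g W \<and>
        (\<forall>S x. surface_in W S \<and> x \<in> S \<longrightarrow>
           (\<Phi> S x, tangent_alpha (\<Phi> S ` S) (\<Phi> S x)) = g (x, tangent_alpha S x)))"

definition tangent_consistent ::
  "corr set \<Rightarrow> (corr \<Rightarrow> corr) \<Rightarrow> (point set \<Rightarrow> point \<Rightarrow> point) \<Rightarrow> bool" where
  "tangent_consistent W f1 \<Phi> \<longleftrightarrow>
     (\<forall>S x. surface_in W S \<and> x \<in> S \<longrightarrow>
        \<Phi> S x = fst (f1 (x, tangent_alpha S x)) \<and>
        tangent_alpha (\<Phi> S ` S) (\<Phi> S x) = snd (f1 (x, tangent_alpha S x)))"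

end

(* A point x and a primed spinor p determine the twistor z = (i x p, p), and the twistors incident
   with x are the (i x q, q).  Along a null curve through x tangent to z the derivative of a lift is
   (i x q, q) for some q, up to multiples of z, so the image curve F(z) has derivative
   DF(z)(i x q, q), which depends on the curve only through q.  By Euler's identity, changing q by
   a multiple of p changes this derivative by a multiple of F(z), so the image point, the unique
   point incident with both twistors, depends on (x, p) alone.  The formula is holomorphic where
   the primed parts of these two twistors are independent.

   Density amounts to DF(z) being invertible for some z.  Otherwise take z maximising
   u(z) = |z|^2 - A |F(z)|^2, which exists for large A as F is homogeneous with no nontrivial zero,
   and v in the kernel of DF(z): on the complex line z + t v the average of u over
   t = r, -r, i r, -i r is u(z) + r^2 |v|^2 + O(r^3).

   A self-dual surface is an open piece of a single affine alpha-plane.  So its twistor z is constant,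
   and injectivity of DF(z) makes the induced map into the alpha-plane of F(z) injective; its image is
   open there by invariance of domain. *)

theory Submission imports Defs begin

section \<open>Holomorphic maps\<close>

text \<open>\<open>nonsingular_region\<close> is defined by quantifying over null curves, a form
  from which neither openness nor density can be read off. In homogeneous coordinates it becomes the
  set of (x, p) at which some \<open>wronskian x p q\<close> is nonzero. The identification needs
  null curves through x, tangent to the alpha-plane of p, whose spinor lift has an arbitrary
  velocity q; an explicit quadratic curve provides them. Regularity is then nonvanishing of
  holomorphic functions, and one point where it holds gives density.

  The representative of a projective spinor and the auxiliary q are arbitrary, so the map on the
  correspondence space is written down globally by choice, while holomorphy is checked locally with
  q fixed.

  Holomorphy means complex differentiability at each point. Continuity of the derivative, on which
  the inverse function theorem for surface charts rests, is therefore derived from Cauchy's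
  inequality.\<close>

lemma holo_onI:
  assumes "open U"
    and "\<And>x. x \<in> U \<Longrightarrow> \<exists>D. (f has_derivative D) (at x) \<and> (\<forall>c v. D (c *\<^sub>C v) = c *\<^sub>C D v)"
  shows "holo_on f U"
  using assms unfolding holo_on_def by blast

lemma holo_on_open: "holo_on f U \<Longrightarrow> open U"
  unfolding holo_on_def by blast

lemma holo_on_derivative:
  assumes "holo_on f U" "x \<in> U"
  shows "(f has_derivative frechet_derivative f (at x)) (at x)"
    and "frechet_derivative f (at x) (c *\<^sub>C v) = c *\<^sub>C frechet_derivative f (at x) v"
proof -
  obtain D where D: "(f has_derivative D) (at x)" "\<forall>c v. D (c *\<^sub>C v) = c *\<^sub>C D v"
    using assms unfolding holo_on_def by blast
  moreover have "D = frechet_derivative f (at x)"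
    by (rule frechet_derivative_at[OF D(1)])
  ultimately show "(f has_derivative frechet_derivative f (at x)) (at x)"
    and "frechet_derivative f (at x) (c *\<^sub>C v) = c *\<^sub>C frechet_derivative f (at x) v"
    by simp_all
qed

lemma holo_on_subset: "holo_on f U \<Longrightarrow> open V \<Longrightarrow> V \<subseteq> U \<Longrightarrow> holo_on f V"
  unfolding holo_on_def by blast

lemma holo_on_imp_continuous_on: "holo_on f U \<Longrightarrow> continuous_on U f"
  by (meson continuous_at_imp_continuous_on has_derivative_continuous holo_on_derivative(1))

lemma holo_on_bounded_linear:
  assumes "bounded_linear L" "\<And>c v. L (c *\<^sub>C v) = c *\<^sub>C L v" "open U"
  shows "holo_on L U"
  using assms bounded_linear_imp_has_derivative by (intro holo_onI) blast+

lemma scaleC_zero_right [simp]: "c *\<^sub>C (0 :: 'a :: complex_space) = 0"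
  using scaleC_add_right[of c 0 "0 :: 'a"] by simp

lemma holo_on_const: "open U \<Longrightarrow> holo_on (\<lambda>x. k) U"
  by (rule holo_onI) (auto intro!: exI[of _ "\<lambda>v. 0"])

lemma holo_on_compose:
  assumes "holo_on g U" "holo_on f V" "g ` U \<subseteq> V"
  shows "holo_on (\<lambda>x. f (g x)) U"
proof (rule holo_onI)
  fix x assume x: "x \<in> U"
  then have gx: "g x \<in> V" using assms(3) by blast
  note d = holo_on_derivative[OF assms(1) x] holo_on_derivative[OF assms(2) gx]
  show "\<exists>D. ((\<lambda>x. f (g x)) has_derivative D) (at x) \<and> (\<forall>c v. D (c *\<^sub>C v) = c *\<^sub>C D v)"
    by (rule exI[of _ "\<lambda>v. frechet_derivative f (at (g x)) (frechet_derivative g (at x) v)"])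
       (use has_derivative_compose[OF d(1) d(3)] d(2,4) in simp)
qed (use holo_on_open[OF assms(1)] in simp)

lemma holo_on_bounded_linear_compose:
  assumes "bounded_linear L" "\<And>c v. L (c *\<^sub>C v) = c *\<^sub>C L v" "holo_on f U"
  shows "holo_on (\<lambda>x. L (f x)) U"
  using holo_on_compose[OF assms(3) holo_on_bounded_linear[OF assms(1,2) open_UNIV]] by simp

lemma holo_on_Pair:
  assumes "holo_on f U" "holo_on g U"
  shows "holo_on (\<lambda>x. (f x, g x)) U"
proof (rule holo_onI)
  fix x assume x: "x \<in> U"
  note d = holo_on_derivative[OF assms(1) x] holo_on_derivative[OF assms(2) x]
  show "\<exists>D. ((\<lambda>x. (f x, g x)) has_derivative D) (at x) \<and> (\<forall>c v. D (c *\<^sub>C v) = c *\<^sub>C D v)"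
    by (rule exI[of _ "\<lambda>v. (frechet_derivative f (at x) v, frechet_derivative g (at x) v)"])
       (use has_derivative_Pair[OF d(1) d(3)] d(2,4) in \<open>simp add: scaleC_prod_def\<close>)
qed (use holo_on_open[OF assms(1)] in simp)

lemma holo_on_fst: "holo_on f U \<Longrightarrow> holo_on (\<lambda>x. fst (f x)) U"
  by (rule holo_on_bounded_linear_compose) (simp_all add: bounded_linear_fst scaleC_prod_def)

lemma holo_on_snd: "holo_on f U \<Longrightarrow> holo_on (\<lambda>x. snd (f x)) U"
  by (rule holo_on_bounded_linear_compose) (simp_all add: bounded_linear_snd scaleC_prod_def)

lemma holo_on_id: "open U \<Longrightarrow> holo_on (\<lambda>x. x) U"
  by (rule holo_on_bounded_linear) (simp_all add: bounded_linear_ident)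

lemma holo_on_vec_nth: "holo_on f U \<Longrightarrow> holo_on (\<lambda>x. f x $ i) U"
  by (rule holo_on_bounded_linear_compose) (auto simp add: scaleC_vec_def bounded_linear_vec_nth)

lemma bounded_linear_axis:
  "bounded_linear (axis i :: 'a::real_normed_vector \<Rightarrow> 'a^'n::finite)"
proof (rule bounded_linear_intro[where K = 1])
  fix x y :: 'a and r :: real
  show "axis i (x + y) = axis i x + axis i y" "axis i (r *\<^sub>R x) = r *\<^sub>R axis i x"
    by (simp_all add: axis_def vec_eq_iff)
  have "norm (axis i x :: 'a^'n) \<le> (\<Sum>j\<in>UNIV. norm (axis i x $ j :: 'a))"
    unfolding norm_vec_def by (rule L2_set_le_sum) simp
  also have "\<dots> = (\<Sum>j\<in>UNIV. if j = i then norm x else 0)"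
    by (intro sum.cong) (auto simp: axis_def)
  finally show "norm (axis i x :: 'a^'n) \<le> norm x * 1" by simp
qed

lemma vec_lambda_eq_sum_axis:
  "(\<chi> i. f i) = (\<Sum>i\<in>UNIV. axis i (f i :: 'a::comm_monoid_add))"
  by (simp add: vec_eq_iff axis_def if_distrib cong: if_cong)

lemma has_derivative_vec_lambda:
  assumes "\<And>i. (f i has_derivative f' i) F"
  shows "((\<lambda>x. \<chi> i. f i x) has_derivative (\<lambda>v. \<chi> i. f' i v)) F"
  unfolding vec_lambda_eq_sum_axis
  by (intro has_derivative_sum bounded_linear.has_derivative[OF bounded_linear_axis] assms)

lemma holo_on_vec_lambda:
  assumes "\<And>i. holo_on (f i) U"
  shows "holo_on (\<lambda>x. \<chi> i. f i x) U"
proof (rule holo_onI)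
  fix x assume x: "x \<in> U"
  note d = holo_on_derivative[OF assms x]
  show "\<exists>D. ((\<lambda>x. \<chi> i. f i x) has_derivative D) (at x) \<and> (\<forall>c v. D (c *\<^sub>C v) = c *\<^sub>C D v)"
    by (rule exI[of _ "\<lambda>v. \<chi> i. frechet_derivative (f i) (at x) v"])
       (use has_derivative_vec_lambda[OF d(1)] d(2) in \<open>simp add: scaleC_vec_def\<close>)
qed (use holo_on_open[OF assms] in simp)

lemma holo_on_add:
  assumes "holo_on f U" "holo_on g U"
  shows "holo_on (\<lambda>x. f x + g x) U"
proof (rule holo_onI)
  fix x assume x: "x \<in> U"
  note d = holo_on_derivative[OF assms(1) x] holo_on_derivative[OF assms(2) x]
  show "\<exists>D. ((\<lambda>x. f x + g x) has_derivative D) (at x) \<and> (\<forall>c v. D (c *\<^sub>C v) = c *\<^sub>C D v)"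
    by (rule exI[of _ "\<lambda>v. frechet_derivative f (at x) v + frechet_derivative g (at x) v"])
       (use has_derivative_add[OF d(1) d(3)] d(2,4) in \<open>simp add: scaleC_add_right\<close>)
qed (use holo_on_open[OF assms(1)] in simp)

lemma holo_on_mult:
  fixes f g :: "'a::complex_space \<Rightarrow> complex"
  assumes "holo_on f U" "holo_on g U"
  shows "holo_on (\<lambda>x. f x * g x) U"
proof (rule holo_onI)
  fix x assume x: "x \<in> U"
  note d = holo_on_derivative[OF assms(1) x] holo_on_derivative[OF assms(2) x]
  show "\<exists>D. ((\<lambda>x. f x * g x) has_derivative D) (at x) \<and> (\<forall>c v. D (c *\<^sub>C v) = c *\<^sub>C D v)"
    by (rule exI[of _ "\<lambda>v. f x * frechet_derivative g (at x) v + frechet_derivative f (at x) v * g x"])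
       (use has_derivative_mult[OF d(1) d(3)] d(2,4) in \<open>simp add: scaleC_complex_def algebra_simps\<close>)
qed (use holo_on_open[OF assms(1)] in simp)

lemma holo_on_minus:
  fixes f :: "'a::complex_space \<Rightarrow> complex"
  shows "holo_on f U \<Longrightarrow> holo_on (\<lambda>x. - f x) U"
  by (rule holo_on_bounded_linear_compose)
     (simp_all add: bounded_linear_minus bounded_linear_ident scaleC_complex_def)

lemma holo_on_diff:
  fixes f g :: "'a::complex_space \<Rightarrow> complex"
  shows "holo_on f U \<Longrightarrow> holo_on g U \<Longrightarrow> holo_on (\<lambda>x. f x - g x) U"
  using holo_on_add[OF _ holo_on_minus] by fastforce

text \<open>A complex-linear map of the complex numbers is multiplication by its value at 1, so in
  one variable \<open>holo_on\<close> is ordinary holomorphy on an open set. This gives access to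
  the identity theorem and to the holomorphy of derivatives.\<close>

lemma holo_on_complex_iff:
  fixes f :: "complex \<Rightarrow> complex"
  shows "holo_on f U \<longleftrightarrow> open U \<and> f holomorphic_on U"
proof
  assume f: "holo_on f U"
  have "f field_differentiable at x" if x: "x \<in> U" for x
  proof -
    note d = holo_on_derivative[OF f x]
    have "frechet_derivative f (at x) v = frechet_derivative f (at x) 1 * v" for v
      using d(2)[of v 1] by (simp add: scaleC_complex_def)
    then have "frechet_derivative f (at x) = (*) (frechet_derivative f (at x) 1)"
      by (rule ext)
    with d(1) show ?thesis
      unfolding field_differentiable_def has_field_derivative_def by metis
  qed
  then show "open U \<and> f holomorphic_on U"
    using holo_on_open[OF f] by (simp add: holomorphic_on_open field_differentiable_def)
next
  assume f: "open U \<and> f holomorphic_on U"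
  show "holo_on f U"
  proof (rule holo_onI)
    fix x assume "x \<in> U"
    then obtain D where "(f has_field_derivative D) (at x)"
      using f holomorphic_on_open by blast
    then show "\<exists>D. (f has_derivative D) (at x) \<and> (\<forall>c v. D (c *\<^sub>C v) = c *\<^sub>C D v)"
      unfolding has_field_derivative_def
      by (intro exI[of _ "(*) D"]) (simp add: scaleC_complex_def)
  qed (use f in simp)
qed

lemma holo_on_divide:
  fixes f g :: "'a::complex_space \<Rightarrow> complex"
  assumes "holo_on f U" "holo_on g U" "\<And>x. x \<in> U \<Longrightarrow> g x \<noteq> 0"
  shows "holo_on (\<lambda>x. f x / g x) U"
proof -
  have "holo_on (inverse :: complex \<Rightarrow> complex) (- {0})"
    unfolding holo_on_complex_iff by (auto intro!: holomorphic_intros)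
  then have "holo_on (\<lambda>x. inverse (g x)) U"
    using assms(3) by (intro holo_on_compose[OF assms(2)]) auto
  then show ?thesis
    unfolding divide_inverse by (rule holo_on_mult[OF assms(1)])
qed

lemma holo_on_sum:
  assumes "finite I" "open U" "\<And>i. i \<in> I \<Longrightarrow> holo_on (f i) U"
  shows "holo_on (\<lambda>x. \<Sum>i\<in>I. f i x) U"
  using assms(1,3) by (induction I) (auto intro: holo_on_const holo_on_add assms(2))

lemma holo_on_prod:
  fixes f :: "'i \<Rightarrow> 'a::complex_space \<Rightarrow> complex"
  assumes "finite I" "open U" "\<And>i. i \<in> I \<Longrightarrow> holo_on (f i) U"
  shows "holo_on (\<lambda>x. \<Prod>i\<in>I. f i x) U"
  using assms(1,3) by (induction I) (auto intro: holo_on_const holo_on_mult assms(2))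

lemma holo_on_has_derivative_bounded_linear:
  "holo_on f U \<Longrightarrow> x \<in> U \<Longrightarrow> bounded_linear (frechet_derivative f (at x))"
  using has_derivative_bounded_linear holo_on_derivative(1) by blast

lemma scaleC_vec_nth [simp]: "(c *\<^sub>C x) $ i = c *\<^sub>C x $ i"
  by (simp add: scaleC_vec_def)

lemma scaleC_complex [simp]: "c *\<^sub>C x = c * (x :: complex)"
  by (simp add: scaleC_complex_def)

lemma scaleC_vec_eq: "c *\<^sub>C (x :: complex^'n::finite) = c *s x"
  by (simp add: vec_eq_iff)

lemma velocity_has_derivative:
  assumes "holo_on X U" "s \<in> U"
  shows "(X has_derivative (\<lambda>t. t *\<^sub>C velocity X s)) (at s)"
proof -
  have "frechet_derivative X (at s) t = t *\<^sub>C velocity X s" for t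
    using holo_on_derivative(2)[OF assms, of t 1] by (simp add: velocity_def)
  then have "frechet_derivative X (at s) = (\<lambda>t. t *\<^sub>C velocity X s)" by blast
  then show ?thesis using holo_on_derivative(1)[OF assms] by simp
qed

lemma scaleC_one [simp]: "1 *\<^sub>C x = (x :: 'a::complex_space)"
  using scaleC_of_real[of 1 x] by simp

lemma velocity_eqI:
  assumes "(X has_derivative D) (at s)"
  shows "velocity X s = D 1"
  using frechet_derivative_at[OF assms] by (simp add: velocity_def)

section \<open>Polynomial maps\<close>

text \<open>Closed under sums and products, unlike homogeneous polynomials of one degree, which
  makes derivatives and restrictions to lines accessible by induction.\<close>

inductive polynomial_fun :: "(complex^'n::finite \<Rightarrow> complex) \<Rightarrow> bool" where
  const: "polynomial_fun (\<lambda>z. c)"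
| coord: "polynomial_fun (\<lambda>z. z $ i)"
| add: "polynomial_fun f \<Longrightarrow> polynomial_fun g \<Longrightarrow> polynomial_fun (\<lambda>z. f z + g z)"
| mult: "polynomial_fun f \<Longrightarrow> polynomial_fun g \<Longrightarrow> polynomial_fun (\<lambda>z. f z * g z)"

lemma polynomial_fun_power: "polynomial_fun f \<Longrightarrow> polynomial_fun (\<lambda>z. f z ^ n)"
  by (induction n) (auto intro: polynomial_fun.intros)

lemma polynomial_fun_sum:
  assumes "\<And>i. i \<in> I \<Longrightarrow> polynomial_fun (f i)"
  shows "polynomial_fun (\<lambda>z. \<Sum>i\<in>I. f i z)"
  using assms by (induction I rule: infinite_finite_induct) (auto intro: polynomial_fun.intros)

lemma polynomial_fun_prod:
  assumes "\<And>i. i \<in> I \<Longrightarrow> polynomial_fun (f i)"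
  shows "polynomial_fun (\<lambda>z. \<Prod>i\<in>I. f i z)"
  using assms by (induction I rule: infinite_finite_induct) (auto intro: polynomial_fun.intros)

lemma homogeneous_polynomial_imp_polynomial_fun:
  assumes "homogeneous_polynomial d P"
  shows "polynomial_fun P"
proof -
  obtain c where "P = (\<lambda>z. \<Sum>\<alpha> | sum \<alpha> UNIV = d. c \<alpha> * (\<Prod>j\<in>UNIV. z $ j ^ \<alpha> j))"
    using assms unfolding homogeneous_polynomial_def by blast
  then show ?thesis
    by (auto intro!: polynomial_fun_sum polynomial_fun.mult polynomial_fun_prod polynomial_fun_power
        polynomial_fun.const polynomial_fun.coord)
qed

lemma homogeneous_polynomial_scale:
  assumes "homogeneous_polynomial d P"
  shows "P (c *s z) = c ^ d * P z"
proof -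
  obtain k where P: "P z = (\<Sum>\<alpha> | sum \<alpha> UNIV = d. k \<alpha> * (\<Prod>j\<in>UNIV. z $ j ^ \<alpha> j))" for z
    using assms unfolding homogeneous_polynomial_def by blast
  have "(\<Prod>j\<in>UNIV. (c *s z) $ j ^ \<alpha> j) = c ^ d * (\<Prod>j\<in>UNIV. z $ j ^ \<alpha> j)"
    if "sum \<alpha> UNIV = d" for \<alpha>
    using that by (simp add: power_mult_distrib prod.distrib flip: power_sum)
  then show ?thesis
    unfolding P sum_distrib_left by (intro sum.cong) (auto simp: algebra_simps)
qed

lemma polynomial_fun_holo: "polynomial_fun f \<Longrightarrow> holo_on f UNIV"
  by (induction rule: polynomial_fun.induct)
     (auto intro!: holo_on_const holo_on_add holo_on_mult holo_on_vec_nth holo_on_id)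

text \<open>Holomorphy is joint in the base point and the direction. The sum and product rules carry
  it through the induction, and the Wronskian and the Jacobian below owe their holomorphy to
  it.\<close>

lemma polynomial_fun_derivative:
  fixes f :: "complex^'n::finite \<Rightarrow> complex"
  assumes "polynomial_fun f"
  shows "\<exists>f'. (\<forall>z. (f has_derivative f' z) (at z)) \<and> holo_on (\<lambda>(z, w). f' z w) UNIV"
  using assms
proof induction
  case (const c)
  show ?case
    by (rule exI[of _ "\<lambda>z w. 0"]) (auto simp: case_prod_unfold intro: holo_on_const)
next
  case (coord i)
  have "((\<lambda>z. z $ i) has_derivative (\<lambda>w. w $ i)) (at z)" for z :: "complex^'n"
    by (rule bounded_linear_imp_has_derivative[OF bounded_linear_vec_nth])
  then show ?case
    by (intro exI[of _ "\<lambda>z w. w $ i"])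
       (auto simp: case_prod_unfold intro!: holo_on_vec_nth holo_on_snd holo_on_id)
next
  case (add f g)
  then obtain f' g' where d: "\<And>z. (f has_derivative f' z) (at z)" "\<And>z. (g has_derivative g' z) (at z)"
    "holo_on (\<lambda>(z, w). f' z w) UNIV" "holo_on (\<lambda>(z, w). g' z w) UNIV" by blast
  show ?case
    by (rule exI[of _ "\<lambda>z w. f' z w + g' z w"])
       (use has_derivative_add[OF d(1,2)] holo_on_add[OF d(3,4)] in \<open>simp add: case_prod_unfold\<close>)
next
  case (mult f g)
  then obtain f' g' where d: "\<And>z. (f has_derivative f' z) (at z)" "\<And>z. (g has_derivative g' z) (at z)"
    "holo_on (\<lambda>(z, w). f' z w) UNIV" "holo_on (\<lambda>(z, w). g' z w) UNIV" by blast
  have "holo_on (\<lambda>x. h (fst x)) UNIV" if "polynomial_fun h"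
    for h :: "complex^'n \<Rightarrow> complex"
    by (rule holo_on_compose[OF holo_on_fst[OF holo_on_id] polynomial_fun_holo[OF that]]) auto
  note h = this[OF mult(1)] this[OF mult(2)]
  show ?case
    by (rule exI[of _ "\<lambda>z w. f z * g' z w + f' z w * g z"])
       (use has_derivative_mult[OF d(1,2)] holo_on_add[OF holo_on_mult[OF h(1) d(4)] holo_on_mult[OF d(3) h(2)]]
        in \<open>simp add: case_prod_unfold\<close>)
qed

lemma polynomial_fun_line:
  assumes "polynomial_fun f"
  shows "\<exists>p. \<forall>t. f (z + t *s v) = poly p t"
  using assms
proof induction
  case (const c)
  show ?case by (rule exI[of _ "[:c:]"]) simp
next
  case (coord i)
  show ?case by (rule exI[of _ "[:z $ i, v $ i:]"]) simp
next
  case (add f g)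
  then show ?case by (metis poly_add)
next
  case (mult f g)
  then show ?case by (metis poly_mult)
qed

section \<open>Existence of a point with injective derivative\<close>

lemma norm_vec_sum_squares: "(norm (z :: complex^'n::finite))\<^sup>2 = (\<Sum>i\<in>UNIV. (cmod (z $ i))\<^sup>2)"
  by (simp add: norm_vec_def L2_set_def sum_nonneg)

text \<open>The terms linear in \<open>v\<close> cancel between r and -r and between i r and -i
  r.\<close>

lemma four_point_sum:
  fixes r :: real
  shows "(cmod (z + of_real r * v))\<^sup>2 + (cmod (z + of_real (- r) * v))\<^sup>2 +
      (cmod (z + \<i> * of_real r * v))\<^sup>2 + (cmod (z + \<i> * of_real (- r) * v))\<^sup>2 =
      4 * (cmod z)\<^sup>2 + 4 * r\<^sup>2 * (cmod v)\<^sup>2"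
  unfolding cmod_power2 by (simp add: power2_eq_square algebra_simps)

text \<open>A real factor is enough, because it will be the square of one of the parameters r, -r, i
  r, -i r.\<close>

lemma cmod_perturb:
  fixes r :: real
  shows "(cmod (a + of_real r * q))\<^sup>2 = (cmod a)\<^sup>2 + r * (2 * Re (q * cnj a)) + r\<^sup>2 * (cmod q)\<^sup>2"
  unfolding cmod_power2 by (simp add: power2_eq_square algebra_simps)

text \<open>As \<open>D v = 0\<close>, the map along the line is F(z0) + t^2 q(t), so to second
  order |F|^2 changes by the real part of t^2 times a constant. This is harmonic in t and cancels
  over the four points, while |z|^2 grows on average by r^2 |v|^2.\<close>

lemma kernel_derivative_not_max:
  fixes F :: "complex^'n::finite \<Rightarrow> complex^'n" and A :: real
  assumes poly: "\<And>i. polynomial_fun (\<lambda>z. F z $ i)"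
    and D: "(F has_derivative D) (at z0)" "\<And>c v. D (c *s v) = c *s D v"
    and v: "D v = 0" "v \<noteq> 0"
    and A: "A > 0"
  shows "\<exists>z. (norm z)\<^sup>2 - A * (norm (F z))\<^sup>2 > (norm z0)\<^sup>2 - A * (norm (F z0))\<^sup>2"
proof (rule ccontr)
  assume "\<not> ?thesis"
  then have mx: "(norm z)\<^sup>2 - A * (norm (F z))\<^sup>2 \<le> (norm z0)\<^sup>2 - A * (norm (F z0))\<^sup>2" for z
    by (meson not_le)
  have "\<exists>q. \<forall>t. F (z0 + t *s v) $ i = F z0 $ i + t\<^sup>2 * poly q t" for i
  proof -
    obtain p where p: "\<And>t. F (z0 + t *s v) $ i = poly p t"
      using polynomial_fun_line[OF poly] by blast
    have line: "((\<lambda>t. z0 + t *s v) has_derivative (\<lambda>t. t *s v)) (at 0)"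
    proof -
      have "((\<lambda>t. \<chi> j. z0 $ j + t * v $ j) has_derivative (\<lambda>t. \<chi> j. t * v $ j)) (at (0::complex))"
        by (rule has_derivative_vec_lambda) (auto intro!: derivative_eq_intros)
      then show ?thesis
        by (simp add: vector_scalar_mult_def plus_vec_def)
    qed
    have "((\<lambda>t. F (z0 + t *s v) $ i) has_derivative (\<lambda>t. D (t *s v) $ i)) (at 0)"
      using has_derivative_compose[OF line, of F D] D(1)
      by (intro bounded_linear.has_derivative[OF bounded_linear_vec_nth]) simp
    then have "(poly p has_derivative (\<lambda>t. 0)) (at 0)"
      using p v(1) D(2) by simp
    moreover have "(poly p has_derivative (\<lambda>t. poly (pderiv p) 0 * t)) (at 0)"
      using poly_DERIV[of p 0] by (simp add: has_field_derivative_def)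
    ultimately have "poly (pderiv p) 0 = 0"
      using has_derivative_unique by (metis mult.right_neutral)
    then have c1: "coeff p 1 = 0"
      by (simp add: poly_0_coeff_0 coeff_pderiv)
    obtain a p1 where "p = pCons a p1" by (cases p)
    moreover obtain b q where "p1 = pCons b q" by (cases p1)
    ultimately have "p = pCons a (pCons 0 q)" using c1 by simp
    then have "poly p t = poly p 0 + t\<^sup>2 * poly q t" for t
      by (simp add: power2_eq_square algebra_simps)
    then show ?thesis using p by (metis p add.right_neutral vector_smult_lzero)
  qed
  then obtain q where q: "\<And>i t. F (z0 + t *s v) $ i = F z0 $ i + t\<^sup>2 * poly (q i) t"
    by metis
  define a where "a = F z0"
  define h where "h i t = 2 * Re (poly (q i) t * cnj (a $ i))" for i t
  define k where "k i t = (cmod (poly (q i) t))\<^sup>2" for i t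
  \<comment> \<open>The four values of |F|^2 add up to 4 |a|^2 + r^2 \<open>g r\<close>. The minus
    signs come from (i r)^2 = -r^2 and make \<open>g\<close> vanish at 0, whereas maximality of
    \<open>z0\<close> bounds \<open>g r\<close> below by a positive constant for every r >
    0.\<close>
  define g where "g r = (\<Sum>i\<in>UNIV. h i (of_real r) + h i (of_real (- r))
      - h i (\<i> * of_real r) - h i (\<i> * of_real (- r))
      + r\<^sup>2 * (k i (of_real r) + k i (of_real (- r)) + k i (\<i> * of_real r) + k i (\<i> * of_real (- r))))"
    for r :: real
  have "continuous_on UNIV g"
    unfolding g_def h_def k_def by (intro continuous_intros)
  then have "isCont g 0" by (simp add: continuous_on_eq_continuous_at)
  then have "(g \<longlongrightarrow> g 0) (at 0)" by (simp add: isCont_def)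
  moreover have "g 0 = 0" by (simp add: g_def)
  ultimately have "(g \<longlongrightarrow> 0) (at_right 0)"
    by (metis filterlim_at_split)
  moreover have "g r \<ge> 4 * (norm v)\<^sup>2 / A" if r: "r > 0" for r
  proof -
    have Fn: "(norm (F (z0 + t *s v)))\<^sup>2 = (norm a)\<^sup>2 + (\<Sum>i\<in>UNIV. s * h i t + r^4 * k i t)"
      if "t\<^sup>2 = of_real s" "s\<^sup>2 = r^4" for t s
      unfolding norm_vec_sum_squares q a_def[symmetric] that(1) cmod_perturb h_def k_def
      by (simp add: sum.distrib that)
    have r2: "(complex_of_real r)\<^sup>2 = of_real (r\<^sup>2)" "(complex_of_real (-r))\<^sup>2 = of_real (r\<^sup>2)"
      "(\<i> * complex_of_real r)\<^sup>2 = of_real (- (r\<^sup>2))" "(\<i> * complex_of_real (-r))\<^sup>2 = of_real (- (r\<^sup>2))"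
      by (simp_all add: power_mult_distrib)
    have r4: "(r\<^sup>2)\<^sup>2 = r^4" "(- (r\<^sup>2))\<^sup>2 = r^4" by simp_all
    let ?z = "\<lambda>t. z0 + t *s v"
    have "(norm (F (?z (of_real r))))\<^sup>2 + (norm (F (?z (of_real (-r)))))\<^sup>2 +
        (norm (F (?z (\<i> * of_real r))))\<^sup>2 + (norm (F (?z (\<i> * of_real (-r)))))\<^sup>2 =
        4 * (norm a)\<^sup>2 + r\<^sup>2 * g r"
      unfolding Fn[OF r2(1) r4(1)] Fn[OF r2(2) r4(1)] Fn[OF r2(3) r4(2)] Fn[OF r2(4) r4(2)]
        g_def sum_distrib_left
      by (simp add: sum.distrib[symmetric] algebra_simps power2_eq_square power4_eq_xxxx
          sum_subtractf[symmetric])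
    moreover have "(norm (?z (of_real r)))\<^sup>2 + (norm (?z (of_real (-r))))\<^sup>2 +
        (norm (?z (\<i> * of_real r)))\<^sup>2 + (norm (?z (\<i> * of_real (-r))))\<^sup>2 =
        4 * (norm z0)\<^sup>2 + 4 * r\<^sup>2 * (norm v)\<^sup>2"
      unfolding norm_vec_sum_squares sum_distrib_left sum.distrib[symmetric]
        vector_add_component vector_smult_component four_point_sum ..
    moreover have "n1 + n2 + n3 + n4 - A * (m1 + m2 + m3 + m4) \<le> 4 * (n - A * m)"
      if "n1 - A * m1 \<le> n - A * m" "n2 - A * m2 \<le> n - A * m"
        "n3 - A * m3 \<le> n - A * m" "n4 - A * m4 \<le> n - A * m" for n1 n2 n3 n4 n m1 m2 m3 m4 m
      using that by (simp add: distrib_left)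
    note this[OF mx[of "?z (of_real r)"] mx[of "?z (of_real (-r))"]
        mx[of "?z (\<i> * of_real r)"] mx[of "?z (\<i> * of_real (-r))"]]
    ultimately have "4 * (norm z0)\<^sup>2 + 4 * r\<^sup>2 * (norm v)\<^sup>2 - A * (4 * (norm a)\<^sup>2 + r\<^sup>2 * g r)
        \<le> 4 * ((norm z0)\<^sup>2 - A * (norm a)\<^sup>2)"
      unfolding a_def by simp
    then have "r\<^sup>2 * (4 * (norm v)\<^sup>2) \<le> r\<^sup>2 * (A * g r)"
      by (simp add: algebra_simps)
    then have "4 * (norm v)\<^sup>2 \<le> A * g r"
      using r by (simp add: mult_le_cancel_left)
    then show ?thesis using A by (simp add: divide_le_eq mult.commute)
  qed
  then have "eventually (\<lambda>r. g r \<ge> 4 * (norm v)\<^sup>2 / A) (at_right 0)"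
    by (auto simp: eventually_at_filter)
  ultimately have "4 * (norm v)\<^sup>2 / A \<le> 0"
    by (rule tendsto_lowerbound) simp
  then show False using A v(2) by (simp add: field_simps)
qed

lemma exists_injective_derivative:
  fixes F :: "complex^'n::finite \<Rightarrow> complex^'n"
  assumes d: "d \<ge> 1" and hom: "\<And>i. homogeneous_polynomial d (\<lambda>z. F z $ i)" and zero: "F -` {0} = {0}"
  shows "\<exists>z. inj (frechet_derivative F (at z))"
proof (rule ccontr)
  assume noninj: "\<not> ?thesis"
  note poly = homogeneous_polynomial_imp_polynomial_fun[OF hom]
  have holF: "holo_on F UNIV"
    using holo_on_vec_lambda[of "\<lambda>i z. F z $ i", OF polynomial_fun_holo[OF poly]] by simp
  have contF: "continuous_on A F" for A
    using holo_on_imp_continuous_on[OF holF] continuous_on_subset by blast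
  have scale: "F (c *s z) = c ^ d *s F z" for c z
    using homogeneous_polynomial_scale[OF hom] by (simp add: vec_eq_iff)
  have F0: "F z = 0 \<longleftrightarrow> z = 0" for z using zero by auto
  let ?S = "sphere (0 :: complex^'n) 1"
  have "axis i 1 \<in> ?S" for i :: 'n by (simp add: norm_axis_1)
  then have "?S \<noteq> {}" by blast
  then have "\<exists>m\<in>?S. \<forall>z\<in>?S. norm (F m) \<le> norm (F z)"
    by (rule continuous_attains_inf[OF compact_sphere _ continuous_on_norm[OF contF]])
  then obtain m where m: "m \<in> ?S" "\<forall>z\<in>?S. norm (F m) \<le> norm (F z)" by (rule bexE)
  define c where "c = norm (F m)"
  have "m \<noteq> 0" using m(1) by auto
  then have "F m \<noteq> 0" by (simp add: F0)
  then have c: "c > 0" by (simp add: c_def)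
  \<comment> \<open>\<open>c\<close> is the minimum of |F| on the unit sphere; homogeneity carries
    the bound to the whole space.\<close>
  have lower: "norm (F z) \<ge> c * norm z ^ d" for z
  proof (cases "z = 0")
    case True
    then show ?thesis using d F0[of 0] by (simp add: power_0_left)
  next
    case False
    define y where "y = inverse (norm z) *\<^sub>R z"
    have sc: "complex_of_real r *s x = r *\<^sub>R x" for r and x :: "complex^'n"
      by (simp add: vec_eq_iff complex_eq_iff)
    have "norm y = 1" using False by (simp add: y_def)
    then have "c \<le> norm (F y)" using m(2) by (simp add: c_def)
    moreover have "F z = complex_of_real (norm z) ^ d *s F y"
      using scale[of "complex_of_real (norm z)" y] False by (simp add: y_def sc)
    then have "norm (F z) = norm z ^ d * norm (F y)"
      using sc[of "norm z ^ d"] by simp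
    ultimately show ?thesis by (simp add: mult.commute mult_right_mono)
  qed
  \<comment> \<open>For |z| > 1 the lower bound gives |F(z)| \<ge> c |z|, hence A |F(z)|^2 \<ge> 2
    |z|^2 and \<open>u z\<close> < 0 = \<open>u 0\<close>. A maximum of \<open>u\<close> over the
    closed unit ball is therefore global.\<close>
  define A where "A = 2 / c\<^sup>2"
  have A: "A > 0" using c by (simp add: A_def)
  define u where "u z = (norm z)\<^sup>2 - A * (norm (F z))\<^sup>2" for z
  have "continuous_on (cball 0 1) u"
    unfolding u_def by (intro continuous_intros contF)
  then obtain z0 where z0: "z0 \<in> cball 0 1" "\<And>z. z \<in> cball 0 1 \<Longrightarrow> u z \<le> u z0"
    using continuous_attains_sup[of "cball 0 1" u] by auto
  have "u 0 = 0" using F0[of 0] by (simp add: u_def)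
  then have u0: "u z0 \<ge> 0" using z0(2)[of 0] by simp
  have mx: "u z \<le> u z0" for z
  proof (cases "norm z \<le> 1")
    case True
    then show ?thesis using z0(2) by simp
  next
    case False
    have "norm z ^ 1 \<le> norm z ^ d"
      using False d by (intro power_increasing) auto
    then have "c * norm z \<le> norm (F z)"
      using lower[of z] c by (smt (verit) mult_left_mono power_one_right)
    then have "(c * norm z)\<^sup>2 \<le> (norm (F z))\<^sup>2"
      using c by (intro power_mono) auto
    then have "A * (c\<^sup>2 * (norm z)\<^sup>2) \<le> A * (norm (F z))\<^sup>2"
      using A by (simp add: power_mult_distrib)
    moreover have "A * (c\<^sup>2 * (norm z)\<^sup>2) = 2 * (norm z)\<^sup>2"
      using c by (simp add: A_def)
    ultimately show ?thesis using u0 by (simp add: u_def) (smt (verit) zero_le_power2)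
  qed
  note D = holo_on_derivative[OF holF UNIV_I]
  let ?D = "frechet_derivative F (at z0)"
  interpret L: bounded_linear ?D by (rule has_derivative_bounded_linear[OF D(1)])
  obtain x y where "?D x = ?D y" "x \<noteq> y"
    using noninj unfolding inj_def by blast
  then have "?D (x - y) = 0" "x - y \<noteq> 0" by (simp_all add: L.diff)
  from kernel_derivative_not_max[OF poly D(1) D(2)[unfolded scaleC_vec_eq] this A]
  show False using mx unfolding u_def by (meson not_le)
qed

section \<open>Projective space\<close>

lemma proj_eq_iff:
  assumes "v \<noteq> 0" "w \<noteq> 0"
  shows "proj v = proj w \<longleftrightarrow> (\<exists>c. c \<noteq> 0 \<and> w = c *s v)"
proof -
  have "proj_rel u u" if "u \<noteq> 0" for u :: "complex^'a"
    using that by (auto simp: proj_rel_def intro!: exI[of _ 1])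
  then have "proj v = proj w \<longleftrightarrow> proj_rel v w"
    using Quotient_rel[OF Quotient_proj, of v w] assms by blast
  then show ?thesis using assms by (simp add: proj_rel_def)
qed

lemma proj_scale [simp]: "v \<noteq> 0 \<Longrightarrow> c \<noteq> 0 \<Longrightarrow> proj (c *s v) = proj v"
  by (metis proj_eq_iff vector_mul_eq_0)

lemma rep_proj_nonzero: "rep_proj a \<noteq> 0"
  using Quotient_rep_reflp[OF Quotient_proj, of a] by (simp add: proj_rel_def)

lemma proj_rep_proj: "proj (rep_proj a) = a"
  by (rule Quotient_abs_rep[OF Quotient_proj])

lemma rep_proj_proj:
  assumes "v \<noteq> 0"
  obtains c where "c \<noteq> 0" "rep_proj (proj v) = c *s v"
proof -
  have "proj v = proj (rep_proj (proj v))" by (simp add: proj_rep_proj)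
  then show ?thesis using assms rep_proj_nonzero proj_eq_iff that by metis
qed

text \<open>The saturation of \<open>B\<close> under scaling is the union of its preimages under the
  homotheties by nonzero scalars, and each of these is open.\<close>

lemma open_image_proj:
  fixes B :: "(complex^'n::finite) set"
  assumes "open B" "0 \<notin> B"
  shows "open (proj ` B)"
proof -
  have eq: "{v. v \<noteq> 0 \<and> proj v \<in> proj ` B} = (\<Union>c\<in>-{0}. (\<lambda>v. c *s v) -` B)"
  proof (intro set_eqI iffI)
    fix v assume "v \<in> {v. v \<noteq> 0 \<and> proj v \<in> proj ` B}"
    then obtain b where b: "v \<noteq> 0" "b \<in> B" "proj v = proj b" by auto
    moreover have "b \<noteq> 0" using b(2) assms(2) by blast
    ultimately obtain c where "c \<noteq> 0" "b = c *s v" using proj_eq_iff by blast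
    then show "v \<in> (\<Union>c\<in>-{0}. (\<lambda>v. c *s v) -` B)" using b(2) by auto
  next
    fix v assume "v \<in> (\<Union>c\<in>-{0}. (\<lambda>v. c *s v) -` B)"
    then obtain c where c: "c \<noteq> 0" "c *s v \<in> B" by auto
    moreover have "v \<noteq> 0" using c(2) assms(2) by auto
    ultimately show "v \<in> {v. v \<noteq> 0 \<and> proj v \<in> proj ` B}"
      using proj_scale by (metis (mono_tags, lifting) image_eqI mem_Collect_eq)
  qed
  have "open ((\<lambda>v. c *s v) -` B)" for c
  proof (rule open_vimage[OF assms(1)])
    have "(\<lambda>v::complex^'n. c *s v) = (\<lambda>v. \<chi> i. c * v $ i)"
      by (simp add: fun_eq_iff vec_eq_iff)
    moreover have "continuous_on UNIV (\<lambda>v::complex^'n. \<chi> i. c * v $ i)"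
      by (intro continuous_intros)
    ultimately show "continuous_on UNIV (\<lambda>v::complex^'n. c *s v)" by simp
  qed
  then show ?thesis
    unfolding open_proj_def eq by blast
qed

lemma open_image_Pair_proj:
  fixes T :: "('a::topological_space \<times> (complex^'n::finite)) set"
  assumes "open T" "\<And>x p. (x, p) \<in> T \<Longrightarrow> p \<noteq> 0"
  shows "open ((\<lambda>(x, p). (x, proj p)) ` T)"
proof (rule Topological_Spaces.openI)
  fix y assume "y \<in> (\<lambda>(x, p). (x, proj p)) ` T"
  then obtain x p where xp: "(x, p) \<in> T" "y = (x, proj p)" by auto
  obtain A B where AB: "open A" "open B" "(x, p) \<in> A \<times> B" "A \<times> B \<subseteq> T"
    using open_prod_elim[OF assms(1) xp(1)] by blast
  have "0 \<notin> B" using AB assms(2) by blast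
  then have "open (A \<times> proj ` B)"
    by (intro open_Times AB(1) open_image_proj[OF AB(2)])
  moreover have "y \<in> A \<times> proj ` B" using AB(3) xp(2) by auto
  moreover have "A \<times> proj ` B \<subseteq> (\<lambda>(x, p). (x, proj p)) ` T" using AB(4) by force
  ultimately show "\<exists>U. open U \<and> y \<in> U \<and> U \<subseteq> (\<lambda>(x, p). (x, proj p)) ` T" by blast
qed

lemma open_vimage_Pair_proj:
  fixes W :: "('a::topological_space \<times> 'n::finite proj) set"
  assumes "open W"
  shows "open {(x, p). p \<noteq> 0 \<and> (x, proj p) \<in> W}"
proof (rule Topological_Spaces.openI)
  fix y assume "y \<in> {(x, p). p \<noteq> 0 \<and> (x, proj p) \<in> W}"
  then obtain x p where xp: "y = (x, p)" "p \<noteq> 0" "(x, proj p) \<in> W" by auto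
  obtain A B where AB: "open A" "open B" "(x, proj p) \<in> A \<times> B" "A \<times> B \<subseteq> W"
    using open_prod_elim[OF assms xp(3)] by blast
  have "open (A \<times> {v. v \<noteq> 0 \<and> proj v \<in> B})"
    using AB(1,2) unfolding open_proj_def by (intro open_Times)
  then show "\<exists>U. open U \<and> y \<in> U \<and> U \<subseteq> {(x, p). p \<noteq> 0 \<and> (x, proj p) \<in> W}"
    using AB(3,4) xp(1,2) by (intro exI[of _ "A \<times> {v. v \<noteq> 0 \<and> proj v \<in> B}"]) auto
qed


section \<open>Spinors and twistors\<close>

lemma spinor_eq_iff: "p = q \<longleftrightarrow> p $ 1 = q $ 1 \<and> p $ 2 = (q :: 'a^2) $ 2"
  by (simp add: vec_eq_iff forall_2)

lemma mv_spinor: "(x *v p) $ A = x $ A $ 1 * p $ 1 + x $ A $ 2 * (p :: complex^2) $ 2"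
  by (simp add: matrix_vector_mult_def sum_2)

lemma contract_eq: "contract p q = p $ 1 * q $ 2 - p $ 2 * q $ 1"
  by (simp add: contract_def raise_def sum_2)

lemma contract_add_left: "contract (p + q) r = contract p r + contract q r"
  and contract_add_right: "contract r (p + q) = contract r p + contract r q"
  and contract_scale_left: "contract (c *s p) r = c * contract p r"
  and contract_scale_right: "contract r (c *s p) = c * contract r p"
  and contract_self [simp]: "contract p p = 0"
  and contract_zero_left [simp]: "contract 0 p = 0"
  and contract_zero_right [simp]: "contract p 0 = 0"
  by (simp_all add: contract_eq algebra_simps)

text \<open>Cramer's rule, in the form of the cyclic identity for three spinors in two dimensions.
  It turns nonvanishing of \<open>contract p q\<close> into \<open>p\<close> and \<open>q\<close>
  being a basis.\<close>

lemma spinor_expand: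
  assumes "contract p q \<noteq> 0"
  shows "r = (contract r q / contract p q) *s p + (contract p r / contract p q) *s q"
proof -
  have "contract p q *s r = contract r q *s p + contract p r *s q"
    by (simp add: spinor_eq_iff contract_eq algebra_simps)
  then have "inverse (contract p q) *s (contract p q *s r) =
      inverse (contract p q) *s (contract r q *s p + contract p r *s q)" by simp
  then show ?thesis
    using assms by (simp add: vector_smult_assoc vector_add_ldistrib divide_inverse mult.commute)
qed

lemma contract_eq_0_imp_scale:
  assumes "p \<noteq> 0" "contract p q = 0"
  obtains c where "q = c *s p"
proof (cases "p $ 1 = 0")
  case True
  with assms(1) have "p $ 2 \<noteq> 0" by (simp add: spinor_eq_iff)
  then have "q = (q $ 2 / p $ 2) *s p"
    using assms(2) True by (simp add: spinor_eq_iff contract_eq)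
  then show ?thesis by (rule that)
next
  case False
  then have "q = (q $ 1 / p $ 1) *s p"
    using assms(2) by (simp add: spinor_eq_iff contract_eq field_simps)
  then show ?thesis by (rule that)
qed

lemma exists_contract_nonzero:
  assumes "p \<noteq> 0"
  obtains q where "contract p q \<noteq> 0"
proof (cases "p $ 1 = 0")
  case True
  with assms have "contract p (vector [1, 0]) \<noteq> 0" by (simp add: contract_eq spinor_eq_iff)
  then show ?thesis by (rule that)
next
  case False
  then have "contract p (vector [0, 1]) \<noteq> 0" by (simp add: contract_eq)
  then show ?thesis by (rule that)
qed

definition twistor_at :: "point \<Rightarrow> spinor \<Rightarrow> twistor" where
  "twistor_at x p = (\<chi> k. case k of Inl A \<Rightarrow> \<i> * (x *v p) $ A | Inr A \<Rightarrow> p $ A)"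

lemma twistor_eq_iff: "z = w \<longleftrightarrow> omega z = omega w \<and> primed z = primed w"
  by (auto simp: omega_def primed_def vec_eq_iff split_sum_all)

lemma omega_twistor_at [simp]: "omega (twistor_at x p) = \<i> *s (x *v p)"
  and primed_twistor_at [simp]: "primed (twistor_at x p) = p"
  by (simp_all add: omega_def primed_def twistor_at_def vec_eq_iff)

lemma omega_add: "omega (z + w) = omega z + omega w"
  and omega_scale: "omega (c *s z) = c *s omega z"
  and primed_add: "primed (z + w) = primed z + primed w"
  and primed_scale: "primed (c *s z) = c *s primed z"
  and primed_zero [simp]: "primed 0 = 0"
  by (simp_all add: omega_def primed_def vec_eq_iff)

lemma incident_iff: "incident x z \<longleftrightarrow> z = twistor_at x (primed z)"
  by (auto simp: incident_def twistor_eq_iff)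

lemma incident_twistor_at [simp]: "incident x (twistor_at x p)"
  by (simp add: incident_def)

lemma twistor_at_add: "twistor_at x (p + q) = twistor_at x p + twistor_at x q"
  by (simp add: twistor_eq_iff omega_add primed_add matrix_vector_right_distrib vector_add_ldistrib)

lemma twistor_at_scale: "twistor_at x (c *s p) = c *s twistor_at x p"
  by (simp add: twistor_eq_iff omega_scale primed_scale vector_smult_assoc mult.commute
      vector_scalar_commute[symmetric])

lemma twistor_at_zero [simp]: "twistor_at x 0 = 0"
  using twistor_at_scale[of x 0 0] by simp

lemma twistor_at_nonzero: "p \<noteq> 0 \<Longrightarrow> twistor_at x p \<noteq> 0"
  by (metis primed_twistor_at primed_zero)

lemma incident_combination:
  "incident x z \<Longrightarrow> incident x w \<Longrightarrow> incident x (a *s z + b *s w)"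
  by (metis incident_iff incident_twistor_at twistor_at_add twistor_at_scale)

lemma incident_scale: "incident x z \<Longrightarrow> incident x (a *s z)"
  by (metis incident_iff incident_twistor_at twistor_at_scale)

text \<open>A matrix is fixed by its action on a basis. For points this says that two twistors with
  independent primed parts have at most one common point; for tangent vectors, that a nonzero one
  annihilates at most one spinor up to scale.\<close>

lemma mv_basis_eqI:
  assumes "x *v p = y *v p" "x *v q = y *v q" "contract p q \<noteq> 0"
  shows "x = (y :: point)"
proof -
  have "x $ A $ 1 = y $ A $ 1 \<and> x $ A $ 2 = y $ A $ 2" for A
  proof -
    define a b where "a = x $ A $ 1 - y $ A $ 1" and "b = x $ A $ 2 - y $ A $ 2"
    have e: "a * p $ 1 + b * p $ 2 = 0" "a * q $ 1 + b * q $ 2 = 0"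
      using arg_cong[OF assms(1), of "\<lambda>v. v $ A"] arg_cong[OF assms(2), of "\<lambda>v. v $ A"]
      by (simp_all add: mv_spinor a_def b_def algebra_simps)
    have "a * contract p q = (a * p $ 1 + b * p $ 2) * q $ 2 - (a * q $ 1 + b * q $ 2) * p $ 2"
      "b * contract p q = (a * q $ 1 + b * q $ 2) * p $ 1 - (a * p $ 1 + b * p $ 2) * q $ 1"
      by (simp_all add: contract_eq algebra_simps)
    then have "a * contract p q = 0" "b * contract p q = 0"
      by (simp_all only: e mult_zero_left diff_self)
    then have "a = 0" "b = 0" using assms(3) by simp_all
    then show ?thesis by (simp add: a_def b_def)
  qed
  then show ?thesis by (simp add: spinor_eq_iff)
qed

lemma incident_unique:
  assumes "incident x z" "incident x w" "incident y z" "incident y w"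
    and "contract (primed z) (primed w) \<noteq> 0"
  shows "x = y"
proof (rule mv_basis_eqI)
  show "x *v primed z = y *v primed z" "x *v primed w = y *v primed w"
    using assms(1-4) by (simp_all add: incident_def vector_mul_lcancel)
qed fact

text \<open>Contracting the numerator with the primed part of either twistor kills one of its two
  terms and turns the other into the denominator times an \<open>omega\<close> part. From here on
  the formula for the inverse of \<open>kappa\<close> is handled through this incidence.\<close>

lemma incident_twistor_point:
  assumes "contract (primed z) (primed w) \<noteq> 0"
  shows "incident (twistor_point z w) z" "incident (twistor_point z w) w"
proof -
  let ?x = "twistor_point z w" and ?c = "contract (primed z) (primed w)"
  have mv: "\<i> * (?x *v p) $ A =
      ((omega z $ A * primed w $ 2 - omega w $ A * primed z $ 2) * p $ 1 +
       (omega w $ A * primed z $ 1 - omega z $ A * primed w $ 1) * p $ 2) / ?c" for p A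
  proof -
    have c: "\<i> * (u / k / \<i> * a) = u * a / k" for u k a :: complex
      by (metis complex_i_not_zero nonzero_mult_div_cancel_left times_divide_eq_left times_divide_eq_right)
    show ?thesis
      unfolding mv_spinor distrib_left twistor_point_def raise_def
      by (simp only: vec_lambda_beta vector_2 c add_divide_distrib[symmetric])
        (simp add: algebra_simps)
  qed
  have "\<i> * (?x *v primed z) $ A = omega z $ A * ?c / ?c" for A
    unfolding mv by (simp add: contract_eq[of "primed z" "primed w"] algebra_simps)
  then show "incident ?x z" using assms by (simp add: incident_def vec_eq_iff)
  have "\<i> * (?x *v primed w) $ A = omega w $ A * ?c / ?c" for A
    unfolding mv by (simp add: contract_eq[of "primed z" "primed w"] algebra_simps)
  then show "incident ?x w" using assms by (simp add: incident_def vec_eq_iff)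
qed

lemma twistor_point_eqI:
  assumes "incident y z" "incident y w" "contract (primed z) (primed w) \<noteq> 0"
  shows "twistor_point z w = y"
  using incident_unique incident_twistor_point assms by blast

lemma primed_class_proj:
  assumes "primed z \<noteq> 0"
  shows "primed_class (proj z) = proj (primed z)"
proof -
  have "z \<noteq> 0" using assms by auto
  then obtain c where "c \<noteq> 0" "rep_proj (proj z) = c *s z" by (rule rep_proj_proj)
  then show ?thesis using assms by (simp add: primed_class_def primed_scale)
qed

section \<open>Homogeneous polynomial self-maps of twistor space\<close>

lemmas holo_intros = holo_on_const holo_on_id holo_on_fst holo_on_snd holo_on_vec_nth
  holo_on_vec_lambda holo_on_Pair holo_on_add holo_on_diff holo_on_minus holo_on_mult

lemma holo_on_component:
  fixes f :: "'a::complex_space \<Rightarrow> 'b::complex_space^'n::finite"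
  assumes "\<And>i. holo_on (\<lambda>x. f x $ i) U"
  shows "holo_on f U"
  using holo_on_vec_lambda[of "\<lambda>i x. f x $ i", OF assms] by simp

lemma holo_on_twistor_at:
  assumes "holo_on f U" "holo_on g U"
  shows "holo_on (\<lambda>u. twistor_at (f u) (g u)) U"
proof (rule holo_on_component)
  fix k :: "2 + 2"
  show "holo_on (\<lambda>u. twistor_at (f u) (g u) $ k) U"
    by (cases k) (auto simp: twistor_at_def mv_spinor
        intro!: holo_intros assms holo_on_open[OF assms(1)])
qed

lemma holo_on_omega: "holo_on f U \<Longrightarrow> holo_on (\<lambda>u. omega (f u)) U"
  and holo_on_primed: "holo_on f U \<Longrightarrow> holo_on (\<lambda>u. primed (f u)) U"
  unfolding omega_def primed_def by (intro holo_intros; assumption)+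

lemma holo_on_contract:
  "holo_on f U \<Longrightarrow> holo_on g U \<Longrightarrow> holo_on (\<lambda>u. contract (f u) (g u)) U"
  unfolding contract_eq by (intro holo_intros)

lemma holo_on_raise:
  assumes "holo_on f U"
  shows "holo_on (\<lambda>u. raise (f u)) U"
proof (rule holo_on_component)
  fix i :: 2
  show "holo_on (\<lambda>u. raise (f u) $ i) U"
    unfolding raise_def using exhaust_2[of i] by (elim disjE; simp; intro holo_intros assms)
qed

lemma holo_on_twistor_point:
  assumes "holo_on f U" "holo_on g U" "\<And>u. u \<in> U \<Longrightarrow> contract (primed (f u)) (primed (g u)) \<noteq> 0"
  shows "holo_on (\<lambda>u. twistor_point (f u) (g u)) U"
proof -
  note h = holo_on_omega[OF assms(1)] holo_on_omega[OF assms(2)]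
    holo_on_primed[OF assms(1)] holo_on_primed[OF assms(2)]
  show ?thesis
    unfolding twistor_point_def
    by (intro holo_intros holo_on_divide holo_on_contract holo_on_raise h assms(3) holo_on_open[OF assms(1)])
       (simp_all add: assms(3))
qed

lemma scaled_has_derivative:
  "((\<lambda>t. t *s z) has_derivative (\<lambda>t. t *s z)) (at (t0::complex))" for z :: "complex^'n::finite"
proof -
  have "((\<lambda>t. \<chi> j. t * z $ j) has_derivative (\<lambda>t. \<chi> j. t * z $ j)) (at t0)"
    by (rule has_derivative_vec_lambda) (auto intro!: derivative_eq_intros)
  then show ?thesis by (simp add: vector_scalar_mult_def)
qed

locale twistor_endomorphism =
  fixes d :: nat and F :: "twistor \<Rightarrow> twistor" and ft :: "CP3 \<Rightarrow> CP3"
  assumes endo: "proj_endomorphism d F ft"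
begin

lemma F_eq_0_iff [simp]: "F z = 0 \<longleftrightarrow> z = 0"
  using endo unfolding proj_endomorphism_def by blast

lemma F_zero [simp]: "F 0 = 0"
  by simp

lemma ft_proj: "z \<noteq> 0 \<Longrightarrow> ft (proj z) = proj (F z)"
  using endo unfolding proj_endomorphism_def by blast

lemma homogeneous_F: "homogeneous_polynomial d (\<lambda>z. F z $ i)"
  using endo unfolding proj_endomorphism_def by blast

lemma F_scale: "F (c *s z) = c ^ d *s F z"
  using homogeneous_polynomial_scale[OF homogeneous_F] by (simp add: vec_eq_iff)

lemma holo_F: "holo_on F UNIV"
  by (rule holo_on_component)
     (rule polynomial_fun_holo[OF homogeneous_polynomial_imp_polynomial_fun[OF homogeneous_F]])

definition DF :: "twistor \<Rightarrow> twistor \<Rightarrow> twistor" where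
  "DF z = frechet_derivative F (at z)"

lemma has_derivative_F: "(F has_derivative DF z) (at z)"
  unfolding DF_def by (rule holo_on_derivative(1)[OF holo_F UNIV_I])

lemma DF_scale: "DF z (c *s w) = c *s DF z w"
  using holo_on_derivative(2)[OF holo_F UNIV_I] by (simp add: DF_def scaleC_vec_eq)

lemma bounded_linear_DF: "bounded_linear (DF z)"
  using has_derivative_F has_derivative_bounded_linear by blast

lemma DF_add: "DF z (v + w) = DF z v + DF z w"
  by (rule linear_add[OF bounded_linear.linear[OF bounded_linear_DF]])

lemma holo_DF: "holo_on (\<lambda>u. DF (fst u) (snd u)) UNIV"
proof (rule holo_on_component)
  fix i
  obtain f' where f': "\<And>z. ((\<lambda>z. F z $ i) has_derivative f' z) (at z)"
    "holo_on (\<lambda>(z, w). f' z w) UNIV"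
    using polynomial_fun_derivative[OF homogeneous_polynomial_imp_polynomial_fun[OF homogeneous_F]]
    by blast
  have "((\<lambda>z. F z $ i) has_derivative (\<lambda>w. DF z w $ i)) (at z)" for z
    by (rule bounded_linear.has_derivative[OF bounded_linear_vec_nth has_derivative_F])
  then have "f' z = (\<lambda>w. DF z w $ i)" for z
    using f'(1) has_derivative_unique by blast
  then show "holo_on (\<lambda>u. DF (fst u) (snd u) $ i) UNIV"
    using f'(2) by (simp add: case_prod_unfold)
qed

lemma holo_on_DF:
  assumes "holo_on f U" "holo_on g U"
  shows "holo_on (\<lambda>u. DF (f u) (g u)) U"
  using holo_on_compose[OF holo_on_Pair[OF assms] holo_DF] by simp

lemma holo_on_F: "holo_on f U \<Longrightarrow> holo_on (\<lambda>u. F (f u)) U"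
  using holo_on_compose[OF _ holo_F] by blast

lemma Euler: "DF z z = of_nat d *s F z"
proof -
  have "((\<lambda>t. F (t *s z)) has_derivative (\<lambda>t. DF z (t *s z))) (at 1)"
    using has_derivative_compose[OF scaled_has_derivative has_derivative_F, of z 1] by simp
  moreover have "((\<lambda>t. t ^ d *s F z) has_derivative (\<lambda>t. (of_nat d * t) *s F z)) (at 1)"
  proof -
    have "((\<lambda>t. \<chi> j. t ^ d * F z $ j) has_derivative (\<lambda>t. \<chi> j. of_nat d * t * F z $ j)) (at 1)"
      by (rule has_derivative_vec_lambda) (auto intro!: derivative_eq_intros)
    then show ?thesis by (simp add: vector_scalar_mult_def)
  qed
  ultimately have "(\<lambda>t. DF z (t *s z)) = (\<lambda>t. (of_nat d * t) *s F z)"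
    unfolding F_scale by (rule has_derivative_unique)
  from fun_cong[OF this, of 1] show ?thesis by simp
qed

lemma d_pos: "d > 0"
  using endo unfolding proj_endomorphism_def by simp

text \<open>The derivative is homogeneous of degree d - 1; \<open>c ^ d / c\<close> avoids a
  subtraction of natural numbers.\<close>

lemma DF_homogeneous:
  assumes "c \<noteq> 0"
  shows "DF (c *s z) w = (c ^ d / c) *s DF z w"
proof -
  have lin: "bounded_linear (\<lambda>z :: twistor. a *s z)" for a
    using scaleC_vec_eq[of a] by (intro linear_conv_bounded_linear[THEN iffD1] linearI)
      (simp_all add: vec_eq_iff algebra_simps)
  have "((\<lambda>z. F (c *s z)) has_derivative (\<lambda>w. DF (c *s z) (c *s w))) (at z)"
    by (rule has_derivative_compose[OF bounded_linear_imp_has_derivative[OF lin] has_derivative_F])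
  moreover have "((\<lambda>z. F (c *s z)) has_derivative (\<lambda>w. c ^ d *s DF z w)) (at z)"
    unfolding F_scale by (rule bounded_linear.has_derivative[OF lin has_derivative_F])
  ultimately have "(\<lambda>w. DF (c *s z) (c *s w)) = (\<lambda>w. c ^ d *s DF z w)"
    by (rule has_derivative_unique)
  from fun_cong[OF this, of "inverse c *s w"] assms show ?thesis
    by (simp add: vector_smult_assoc DF_scale divide_inverse)
qed

section \<open>Wronskian and image point of a pair (x, p)\<close>

text \<open>If the spinor lift of a null curve through \<open>x\<close> passes through
  \<open>p\<close> with velocity \<open>q\<close>, this is the denominator of
  \<open>kappa_inv\<close> for the image curve.\<close>

definition wronskian :: "point \<Rightarrow> spinor \<Rightarrow> spinor \<Rightarrow> complex" where
  "wronskian x p q =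
     contract (primed (F (twistor_at x p))) (primed (DF (twistor_at x p) (twistor_at x q)))"

definition image_point :: "point \<Rightarrow> spinor \<Rightarrow> spinor \<Rightarrow> point" where
  "image_point x p q = twistor_point (F (twistor_at x p)) (DF (twistor_at x p) (twistor_at x q))"

lemma DF_twistor_at_combination:
  "DF (twistor_at x p) (twistor_at x (a *s p + b *s q)) =
     (a * of_nat d) *s F (twistor_at x p) + b *s DF (twistor_at x p) (twistor_at x q)"
  by (simp add: twistor_at_add twistor_at_scale DF_add DF_scale Euler vector_smult_assoc)

lemma wronskian_combination: "wronskian x p (a *s p + b *s q) = b * wronskian x p q"
  unfolding wronskian_def DF_twistor_at_combination
  by (simp add: primed_add primed_scale contract_add_right contract_scale_right)

lemma wronskian_nonzero_imp:
  assumes "wronskian x p q \<noteq> 0"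
  shows "contract p q \<noteq> 0" "p \<noteq> 0" "primed (F (twistor_at x p)) \<noteq> 0"
proof -
  show "primed (F (twistor_at x p)) \<noteq> 0" using assms by (auto simp: wronskian_def)
  then show p: "p \<noteq> 0" by auto
  show "contract p q \<noteq> 0"
  proof
    assume "contract p q = 0"
    then obtain c where "q = c *s p" by (rule contract_eq_0_imp_scale[OF p])
    then have "wronskian x p q = 0" using wronskian_combination[of x p c 0 0] by simp
    then show False using assms by simp
  qed
qed

text \<open>For fixed \<open>x\<close> and \<open>p\<close> the Wronskian is proportional to
  \<open>contract p q\<close>. Whether it vanishes is thus a property of (x, p), tested by any one
  spinor independent of \<open>p\<close>.\<close>

lemma wronskian_nonzero_transfer:
  assumes "wronskian x p q \<noteq> 0" "contract p r \<noteq> 0"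
  shows "wronskian x p r \<noteq> 0"
proof -
  note c = wronskian_nonzero_imp(1)[OF assms(1)]
  have "wronskian x p r = (contract p r / contract p q) * wronskian x p q"
    by (subst spinor_expand[OF c, of r]) (rule wronskian_combination)
  then show ?thesis using assms c by simp
qed

lemma wronskian_scale:
  assumes "c \<noteq> 0"
  shows "wronskian x (c *s p) q = (c ^ d * (c ^ d / c)) * wronskian x p q"
  unfolding wronskian_def twistor_at_scale F_scale DF_homogeneous[OF assms] primed_scale
    contract_scale_left contract_scale_right by simp

text \<open>The twistors over \<open>p\<close> and \<open>q\<close> span all those incident with
  \<open>x\<close>, so the derivative maps this whole space into the twistors incident with the
  image point. Having the second incidence for every \<open>r\<close> is what makes the image
  independent of the curve.\<close>

lemma incident_image_point:
  assumes "wronskian x p q \<noteq> 0"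
  shows "incident (image_point x p q) (F (twistor_at x p))"
    and "incident (image_point x p q) (DF (twistor_at x p) (twistor_at x r))"
proof -
  note i = incident_twistor_point[OF assms[unfolded wronskian_def], folded image_point_def]
  then show "incident (image_point x p q) (F (twistor_at x p))" by simp
  show "incident (image_point x p q) (DF (twistor_at x p) (twistor_at x r))"
    by (subst spinor_expand[OF wronskian_nonzero_imp(1)[OF assms], of r])
       (use i DF_twistor_at_combination incident_combination in metis)
qed

lemma image_point_eq:
  assumes "wronskian x p q \<noteq> 0" "wronskian x (c *s p) r \<noteq> 0" "c \<noteq> 0"
  shows "image_point x (c *s p) r = image_point x p q"
  unfolding image_point_def[of x "c *s p"]
proof (rule twistor_point_eqI)
  note i = incident_image_point[OF assms(1)]
  show "incident (image_point x p q) (F (twistor_at x (c *s p)))"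
    unfolding twistor_at_scale F_scale by (rule incident_scale[OF i(1)])
  show "incident (image_point x p q) (DF (twistor_at x (c *s p)) (twistor_at x r))"
    unfolding twistor_at_scale[of x c] DF_homogeneous[OF assms(3)] by (rule incident_scale[OF i(2)])
qed (use assms(2) in \<open>simp add: wronskian_def\<close>)

lemma holo_wronskian: "holo_on (\<lambda>u. wronskian (fst u) (snd u) q) UNIV"
  unfolding wronskian_def
  by (intro holo_on_contract holo_on_primed holo_on_F holo_on_DF holo_on_twistor_at
      holo_on_fst holo_on_snd holo_on_id holo_on_const open_UNIV)

lemma open_wronskian: "open {(x, p). wronskian x p q \<noteq> 0}"
proof -
  have "open ((\<lambda>u. wronskian (fst u) (snd u) q) -` (- {0}))"
    by (intro open_vimage holo_on_imp_continuous_on holo_wronskian) auto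
  then show ?thesis by (simp add: vimage_def case_prod_unfold)
qed

lemma holo_image_point:
  "holo_on (\<lambda>u. image_point (fst u) (snd u) q) {(x, p). wronskian x p q \<noteq> 0}"
  unfolding image_point_def
  by (rule holo_on_twistor_point)
     (auto simp: wronskian_def[symmetric] intro!: holo_on_F holo_on_DF holo_on_twistor_at
       holo_on_fst holo_on_snd holo_on_id holo_on_const open_wronskian)

section \<open>The induced map on the correspondence space\<close>

text \<open>Counterpart of \<open>nonsingular_region\<close> in homogeneous coordinates. The
  direction \<open>q\<close> has to vary, as no single one is independent of every
  \<open>p\<close>.\<close>

definition nonsingular_set :: "(point \<times> spinor) set" where
  "nonsingular_set = {(x, p). \<exists>q. wronskian x p q \<noteq> 0}"

lemma open_nonsingular_set: "open nonsingular_set"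
proof -
  have "nonsingular_set = (\<Union>q. {(x, p). wronskian x p q \<noteq> 0})"
    by (auto simp: nonsingular_set_def)
  then show ?thesis using open_wronskian by auto
qed

lemma nonsingular_set_scale:
  assumes "c \<noteq> 0"
  shows "(x, c *s p) \<in> nonsingular_set \<longleftrightarrow> (x, p) \<in> nonsingular_set"
  using assms by (simp add: nonsingular_set_def wronskian_scale)

text \<open>The representative of \<open>a\<close> and the direction are both picked by choice, and
  on the nonsingular region the value depends on neither. Elsewhere no direction qualifies, and the
  point component is the default 0 of a division by zero.\<close>

definition corr_map :: "corr \<Rightarrow> corr" where
  "corr_map = (\<lambda>(x, a). (image_point x (rep_proj a) (SOME q. wronskian x (rep_proj a) q \<noteq> 0),
      proj (primed (F (twistor_at x (rep_proj a))))))"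

lemma corr_map_eq:
  assumes "wronskian x p q \<noteq> 0"
  shows "corr_map (x, proj p) = (image_point x p q, proj (primed (F (twistor_at x p))))"
proof -
  note nz = wronskian_nonzero_imp[OF assms]
  obtain c where c: "c \<noteq> 0" "rep_proj (proj p) = c *s p"
    using nz(2) by (rule rep_proj_proj)
  have "wronskian x (c *s p) q \<noteq> 0" using assms c(1) by (simp add: wronskian_scale)
  then have "wronskian x (c *s p) (SOME q. wronskian x (c *s p) q \<noteq> 0) \<noteq> 0"
    by (rule someI[of "\<lambda>q. wronskian x (c *s p) q \<noteq> 0"])
  from image_point_eq[OF assms this c(1)] show ?thesis
    using nz(3) c(1) by (simp add: corr_map_def c(2) twistor_at_scale F_scale primed_scale)
qed

lemma corr_holo_corr_map:
  assumes "open W" and W: "\<And>x p. p \<noteq> 0 \<Longrightarrow> (x, proj p) \<in> W \<Longrightarrow> (x, p) \<in> nonsingular_set"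
  shows "corr_holo_on corr_map W"
  unfolding corr_holo_on_def
proof (intro conjI allI impI)
  fix x p assume xp: "p \<noteq> 0 \<and> (x, proj p) \<in> W"
  \<comment> \<open>The choice inside \<open>corr_map\<close> need not vary holomorphically. A
    direction \<open>e\<close> that works at (x, p) still works nearby, and with \<open>e\<close>
    fixed the same value is given by a holomorphic formula.\<close>
  then obtain e where e: "wronskian x p e \<noteq> 0"
    using W by (auto simp: nonsingular_set_def)
  let ?V = "{(y, q). q \<noteq> 0 \<and> (y, proj q) \<in> W} \<inter> {(y, q). wronskian y q e \<noteq> 0}"
  let ?h = "\<lambda>u. (image_point (fst u) (snd u) e, primed (F (twistor_at (fst u) (snd u))))"
  have V: "open ?V" by (intro open_Int open_vimage_Pair_proj assms(1) open_wronskian)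
  have "holo_on ?h ?V"
    by (intro holo_on_Pair holo_on_primed holo_on_F holo_on_twistor_at holo_on_fst holo_on_snd
        holo_on_id V holo_on_subset[OF holo_image_point V]) auto
  then show "\<exists>V h. (x, p) \<in> V \<and> holo_on h V \<and>
           (\<forall>(y, q)\<in>V. q \<noteq> 0 \<and> (y, proj q) \<in> W \<and> snd (h (y, q)) \<noteq> 0 \<and>
               corr_map (y, proj q) = (fst (h (y, q)), proj (snd (h (y, q)))))"
    using xp e by (intro exI[of _ ?V] exI[of _ ?h])
      (auto simp: corr_map_eq dest: wronskian_nonzero_imp(3))
qed (rule assms(1))

end

section \<open>Null curves\<close>

lemma velocity_nth:
  fixes X :: "complex \<Rightarrow> 'a::complex_space^'n::finite"
  assumes "holo_on X U" "s \<in> U"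
  shows "velocity X s $ i = velocity (\<lambda>t. X t $ i) s"
proof -
  have "((\<lambda>t. X t $ i) has_derivative (\<lambda>t. (t *\<^sub>C velocity X s) $ i)) (at s)"
    by (rule bounded_linear.has_derivative[OF bounded_linear_vec_nth velocity_has_derivative[OF assms]])
  from velocity_eqI[OF this] show ?thesis by simp
qed

lemma velocity_has_field_derivative:
  assumes "holo_on f U" "s \<in> U"
  shows "(f has_field_derivative velocity f s) (at s)"
proof -
  have "(*) (velocity f s) = (\<lambda>t. t *\<^sub>C velocity f s)" by (simp add: fun_eq_iff)
  then show ?thesis
    using velocity_has_derivative[OF assms] unfolding has_field_derivative_def by simp
qed

lemma velocity_nth_has_field_derivative:
  fixes X :: "complex \<Rightarrow> complex^'n::finite"
  assumes "holo_on X U" "s \<in> U"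
  shows "((\<lambda>t. X t $ i) has_field_derivative velocity X s $ i) (at s)"
  using velocity_has_field_derivative[OF holo_on_vec_nth[OF assms(1)] assms(2)]
    velocity_nth[OF assms] by simp

lemma velocity_nth2_has_field_derivative:
  fixes X :: "complex \<Rightarrow> complex^'n::finite^'m::finite"
  assumes "holo_on X U" "s \<in> U"
  shows "((\<lambda>t. X t $ i $ j) has_field_derivative velocity X s $ i $ j) (at s)"
  using velocity_nth_has_field_derivative[OF holo_on_vec_nth[OF assms(1)] assms(2)]
    velocity_nth[OF assms] by simp

lemma velocity_compose_holo:
  assumes "holo_on z U" "z ` U \<subseteq> V" "s \<in> U" "holo_on f V"
  shows "velocity (\<lambda>t. f (z t)) s = frechet_derivative f (at (z s)) (velocity z s)"
proof -
  have "z s \<in> V" using assms by blast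
  from has_derivative_compose[OF velocity_has_derivative[OF assms(1,3)]
      holo_on_derivative(1)[OF assms(4) this]]
  show ?thesis by (rule velocity_eqI[THEN trans]) simp
qed

lemma holo_on_velocity:
  fixes X :: "complex \<Rightarrow> point"
  assumes "holo_on X U"
  shows "holo_on (velocity X) U"
proof (intro holo_on_component)
  fix i j :: 2
  have h: "holo_on (\<lambda>t. X t $ i $ j) U" by (intro holo_on_vec_nth assms)
  then have "open U \<and> deriv (\<lambda>t. X t $ i $ j) holomorphic_on U"
    by (simp add: holo_on_complex_iff holomorphic_deriv)
  then have d: "holo_on (deriv (\<lambda>t. X t $ i $ j)) U" by (simp add: holo_on_complex_iff)
  have eq: "velocity X t $ i $ j = deriv (\<lambda>t. X t $ i $ j) t" if "t \<in> U" for t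
    using DERIV_imp_deriv[OF velocity_nth2_has_field_derivative[OF assms that]] by simp
  show "holo_on (\<lambda>t. velocity X t $ i $ j) U"
    using d holomorphic_transform[of "deriv (\<lambda>t. X t $ i $ j)" U "\<lambda>t. velocity X t $ i $ j"] eq
    by (simp add: holo_on_complex_iff)
qed

text \<open>A nonzero row (a, b) of the velocity annihilates the spinor (-b, a), and so does the
  other row because the determinant vanishes. The chosen row may vanish elsewhere on the curve,
  hence the restriction to a neighbourhood of \<open>s\<close>.\<close>

lemma null_curve_kernel:
  assumes "null_curve X"
  obtains U p where "s \<in> U" "holo_on p U" "\<forall>t\<in>U. p t \<noteq> 0 \<and> velocity X t *v p t = 0"
proof -
  let ?V = "velocity X"
  have X: "holo_on X UNIV" "\<And>t. ?V t \<noteq> 0" "\<And>t. det (?V t) = 0"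
    using assms by (auto simp: null_curve_def)
  obtain A where A: "?V s $ A \<noteq> 0" using X(2)[of s] by (auto simp: vec_eq_iff)
  define p :: "complex \<Rightarrow> spinor" where "p t = (\<chi> B. if B = 1 then - ?V t $ A $ 2 else ?V t $ A $ 1)" for t
  have hp: "holo_on p UNIV"
    unfolding p_def
  proof (rule holo_on_vec_lambda)
    fix B :: 2
    show "holo_on (\<lambda>t. if B = 1 then - ?V t $ A $ 2 else ?V t $ A $ 1) UNIV"
      using holo_on_velocity[OF X(1)] by (cases "B = 1") (auto intro!: holo_intros)
  qed
  have "open (p -` (- {0}))"
    by (rule open_vimage[OF _ holo_on_imp_continuous_on[OF hp]]) auto
  then have h: "holo_on p (p -` (- {0}))" by (rule holo_on_subset[OF hp]) simp
  have k: "?V t *v p t = 0" for t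
  proof -
    have "?V t $ 1 $ 1 * ?V t $ 2 $ 2 = ?V t $ 1 $ 2 * ?V t $ 2 $ 1"
      using X(3)[of t] by (simp add: det_2)
    then show ?thesis
      using exhaust_2[of A] by (elim disjE) (simp_all add: spinor_eq_iff mv_spinor p_def mult.commute)
  qed
  have "s \<in> p -` (- {0})" using A by (auto simp: p_def spinor_eq_iff)
  then show ?thesis using h by (rule that) (simp add: k)
qed

lemma kappa_eq:
  assumes "velocity X s \<noteq> 0" "p \<noteq> 0" "velocity X s *v p = 0"
  shows "kappa X s = proj (twistor_at (X s) p)"
  unfolding kappa_def
proof (rule the_equality)
  show "\<exists>z. z \<noteq> 0 \<and> proj (twistor_at (X s) p) = proj z \<and> incident (X s) z \<and> velocity X s *v primed z = 0"
    using assms twistor_at_nonzero by (intro exI[of _ "twistor_at (X s) p"]) simp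
next
  fix Z assume "\<exists>z. z \<noteq> 0 \<and> Z = proj z \<and> incident (X s) z \<and> velocity X s *v primed z = 0"
  then obtain z where z: "z \<noteq> 0" "Z = proj z" "incident (X s) z" "velocity X s *v primed z = 0"
    by blast
  have zt: "z = twistor_at (X s) (primed z)" using z(3) by (simp add: incident_iff)
  \<comment> \<open>A velocity annihilating two independent spinors would be zero.\<close>
  have "contract p (primed z) = 0"
    using mv_basis_eqI[of "velocity X s" p 0 "primed z"] assms z(4) by auto
  then obtain c where c: "primed z = c *s p" by (rule contract_eq_0_imp_scale[OF assms(2)])
  have "z = c *s twistor_at (X s) p" using zt c twistor_at_scale by metis
  moreover from this have "c \<noteq> 0" using z(1) by auto
  ultimately show "Z = proj (twistor_at (X s) p)"
    using z(2) proj_scale[OF twistor_at_nonzero[OF assms(2)]] by simp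
qed

text \<open>In the derivative i (X' p + X p') of the \<open>omega\<close> part, the term X' p
  vanishes by tangency, so the velocity of the lift is itself incident with
  \<open>X s\<close>.\<close>

lemma velocity_twistor_at:
  assumes "holo_on X U" "holo_on p U" "s \<in> U" "velocity X s *v p s = 0"
  shows "velocity (\<lambda>t. twistor_at (X t) (p t)) s = twistor_at (X s) (velocity p s)"
proof -
  let ?z = "\<lambda>t. twistor_at (X t) (p t)"
  have hz: "holo_on ?z U" by (rule holo_on_twistor_at[OF assms(1,2)])
  have "velocity ?z s $ k = twistor_at (X s) (velocity p s) $ k" for k
  proof (cases k)
    case (Inl A)
    note X = velocity_nth2_has_field_derivative[OF assms(1,3)]
      and p = velocity_nth_has_field_derivative[OF assms(2,3)]
    have "((\<lambda>t. \<i> * (X t $ A $ 1 * p t $ 1 + X t $ A $ 2 * p t $ 2)) has_field_derivative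
        \<i> * ((velocity X s *v p s) $ A + (X s *v velocity p s) $ A)) (at s)"
      by (rule derivative_eq_intros X p refl)+ (simp add: mv_spinor algebra_simps)
    then have "((\<lambda>t. ?z t $ k) has_field_derivative twistor_at (X s) (velocity p s) $ k) (at s)"
      using assms(4) by (simp add: Inl twistor_at_def mv_spinor)
    then show ?thesis
      using velocity_nth_has_field_derivative[OF hz assms(3)] DERIV_unique by blast
  next
    case (Inr A)
    have "((\<lambda>t. ?z t $ k) has_field_derivative twistor_at (X s) (velocity p s) $ k) (at s)"
      using velocity_nth_has_field_derivative[OF assms(2,3)] by (simp add: Inr twistor_at_def)
    then show ?thesis
      using velocity_nth_has_field_derivative[OF hz assms(3)] DERIV_unique by blast
  qed
  then show ?thesis by (simp add: vec_eq_iff)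
qed

section \<open>Independence of the lift to homogeneous coordinates\<close>

text \<open>Proportionality at each point says nothing about how the factor varies. Dividing by a
  coordinate that does not vanish at \<open>s\<close> shows it to be a holomorphic function c, and
  the product rule gives \<open>a\<close> = c(s) and \<open>b\<close> = c'(s).\<close>

lemma curve_lift_compare:
  assumes "curve_lift Z U z" "curve_lift Z U' w" "s \<in> U" "s \<in> U'"
  obtains a b where "a \<noteq> 0" "w s = a *s z s" "velocity w s = b *s z s + a *s velocity z s"
proof -
  have z: "holo_on z U" "\<And>t. t \<in> U \<Longrightarrow> z t \<noteq> 0 \<and> Z t = proj (z t)"
    and w: "holo_on w U'" "\<And>t. t \<in> U' \<Longrightarrow> w t \<noteq> 0 \<and> Z t = proj (w t)"
    using assms(1,2) by (auto simp: curve_lift_def)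
  obtain i where i: "z s $ i \<noteq> 0" using z(2)[OF assms(3)] by (auto simp: vec_eq_iff)
  define W where "W = (U \<inter> (\<lambda>t. z t $ i) -` (- {0})) \<inter> U'"
  have "open (U \<inter> (\<lambda>t. z t $ i) -` (- {0}))"
    by (rule continuous_open_preimage[OF holo_on_imp_continuous_on[OF holo_on_vec_nth[OF z(1)]]
          holo_on_open[OF z(1)]]) auto
  then have W: "open W" "s \<in> W" "W \<subseteq> U" "W \<subseteq> U'"
    unfolding W_def using holo_on_open[OF w(1)] assms(3,4) i by auto
  define c where "c t = w t $ i / z t $ i" for t
  have c: "w t = c t *s z t" if t: "t \<in> W" for t
  proof -
    have "t \<in> U" "t \<in> U'" using t W by auto
    then have "proj (z t) = proj (w t)" "z t \<noteq> 0" "w t \<noteq> 0"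
      using z(2) w(2) by metis+
    then obtain k where "w t = k *s z t" using proj_eq_iff by blast
    moreover from this have "c t = k" using t by (simp add: c_def W_def)
    ultimately show ?thesis by simp
  qed
  have zW: "holo_on z W" and wW: "holo_on w W"
    using z(1) w(1) W holo_on_subset by blast+
  have "holo_on c W"
    unfolding c_def using zW wW by (intro holo_on_divide holo_on_vec_nth) (auto simp: W_def)
  note dc = velocity_has_field_derivative[OF this W(2)]
  have "velocity w s $ j = (velocity c s *s z s + c s *s velocity z s) $ j" for j
  proof -
    have "((\<lambda>t. c t * z t $ j) has_field_derivative
        (velocity c s *s z s + c s *s velocity z s) $ j) (at s)"
      by (rule derivative_eq_intros dc velocity_nth_has_field_derivative[OF zW W(2)] refl)+
         (simp add: algebra_simps)
    then have "((\<lambda>t. w t $ j) has_field_derivative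
        (velocity c s *s z s + c s *s velocity z s) $ j) (at s)"
      by (rule has_field_derivative_transform_within_open[OF _ W(1,2)]) (simp add: c)
    then show ?thesis
      using velocity_nth_has_field_derivative[OF wW W(2)] DERIV_unique by blast
  qed
  then have "velocity w s = velocity c s *s z s + c s *s velocity z s"
    by (simp add: vec_eq_iff)
  moreover have "c s \<noteq> 0" using c[OF W(2)] w(2)[OF assms(4)] by auto
  ultimately show ?thesis using that c[OF W(2)] by blast
qed

text \<open>Rescaling a lift multiplies the denominator by the square of the factor; the derivative
  of the factor drops out, as a spinor contracts with itself to zero. The point stays incident with
  both vectors of the new pair, hence is unchanged.\<close>

lemma contract_curve_lift:
  assumes "curve_lift Z U z" "curve_lift Z U' w" "s \<in> U" "s \<in> U'"
    and "contract (primed (w s)) (primed (velocity w s)) \<noteq> 0"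
  shows "contract (primed (z s)) (primed (velocity z s)) \<noteq> 0"
    and "twistor_point (w s) (velocity w s) = twistor_point (z s) (velocity z s)"
proof -
  obtain a b where ab: "a \<noteq> 0" "w s = a *s z s" "velocity w s = b *s z s + a *s velocity z s"
    by (rule curve_lift_compare[OF assms(1-4)])
  have "contract (primed (w s)) (primed (velocity w s)) =
      a * a * contract (primed (z s)) (primed (velocity z s))"
    unfolding ab(2,3) primed_add primed_scale contract_scale_left contract_add_right
      contract_scale_right contract_self by simp
  then show nz: "contract (primed (z s)) (primed (velocity z s)) \<noteq> 0" using assms(5) by auto
  note i = incident_twistor_point[OF nz]
  show "twistor_point (w s) (velocity w s) = twistor_point (z s) (velocity z s)"
  proof (rule twistor_point_eqI[OF _ _ assms(5)])
    show "incident (twistor_point (z s) (velocity z s)) (w s)"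
      unfolding ab(2) by (rule incident_scale[OF i(1)])
    show "incident (twistor_point (z s) (velocity z s)) (velocity w s)"
      unfolding ab(3) by (rule incident_combination[OF i])
  qed
qed

lemma nonsingular_at_iff:
  assumes "curve_lift Z U z" "s \<in> U"
  shows "nonsingular_at Z s \<longleftrightarrow> contract (primed (z s)) (primed (velocity z s)) \<noteq> 0"
  unfolding nonsingular_at_def
  using assms contract_curve_lift(1)[OF assms(1) _ assms(2)] by blast

lemma kappa_inv_eq:
  assumes "curve_lift Z U z" "s \<in> U" "contract (primed (z s)) (primed (velocity z s)) \<noteq> 0"
  shows "kappa_inv Z s = twistor_point (z s) (velocity z s)"
  unfolding kappa_inv_def
proof (rule the_equality)
  fix x
  assume "\<exists>U z. s \<in> U \<and> curve_lift Z U z \<and> contract (primed (z s)) (primed (velocity z s)) \<noteq> 0 \<and>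
      x = twistor_point (z s) (velocity z s)"
  then obtain U' w where "s \<in> U'" "curve_lift Z U' w"
    "contract (primed (w s)) (primed (velocity w s)) \<noteq> 0" "x = twistor_point (w s) (velocity w s)"
    by blast
  then show "x = twistor_point (z s) (velocity z s)"
    using contract_curve_lift(2)[OF assms(1) _ assms(2)] by blast
qed (use assms in blast)

lemma raise_eq_0: "(\<And>B. raise w $ B = 0) \<Longrightarrow> w = 0"
  by (metis add.inverse_inverse neg_equal_0_iff_equal raise_def spinor_eq_iff vector_2 zero_index)

text \<open>Only the first row moves, which keeps the determinant zero. Its velocity is p + t q with
  raised index, which annihilates p + t q itself; integrating gives a quadratic curve and the factor
  1/2. The lift p + t q has the prescribed velocity \<open>q\<close>.\<close>

lemma exists_null_curve:
  assumes "contract p q \<noteq> 0"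
  obtains X where "null_curve X" "X 0 = x" "\<And>t. velocity X t *v (p + t *s q) = 0"
proof -
  define X :: "complex \<Rightarrow> point" where
    "X t = (\<chi> A B. x $ A $ B + (if A = 1 then t * raise p $ B + t\<^sup>2 * (raise q $ B / 2) else 0))" for t
  define V :: "complex \<Rightarrow> point" where
    "V t = (\<chi> A B. if A = 1 then raise (p + t *s q) $ B else 0)" for t
  have r: "raise (p + t *s q) $ B = raise p $ B + t * raise q $ B" for t B
    using exhaust_2[of B] by (auto simp: raise_def)
  have hX: "holo_on X UNIV"
  proof -
    have "holo_on (\<lambda>t. x $ A $ B + (if A = 1 then t * raise p $ B + t * t * (raise q $ B / 2) else 0))
        (UNIV :: complex set)" for A B :: 2
      by (cases "A = 1"; simp only: if_True if_False simp_thms; intro holo_intros open_UNIV)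
    then show ?thesis
      unfolding X_def power2_eq_square by (intro holo_on_vec_lambda) simp
  qed
  have V: "velocity X t = V t" for t
  proof -
    have "((\<lambda>t. X t $ A $ B) has_field_derivative V t $ A $ B) (at t)" for A B
      by (cases "A = 1") (auto simp: X_def V_def r intro!: derivative_eq_intros)
    then have "velocity X t $ A $ B = V t $ A $ B" for A B
      using velocity_nth2_has_field_derivative[OF hX UNIV_I] DERIV_unique by blast
    then show ?thesis by (simp add: vec_eq_iff)
  qed
  have nz: "p + t *s q \<noteq> 0" for t
  proof
    assume "p + t *s q = 0"
    then have "contract (p + t *s q) q = 0" by simp
    then show False using assms by (simp add: contract_add_left contract_scale_left)
  qed
  \<comment> \<open>Contracting the first row with \<open>q\<close> kills the quadratic term and
    leaves -t times \<open>contract p q\<close>. The parameter is thus a continuous function of the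
    point, which makes the curve an embedding.\<close>
  define g :: "point \<Rightarrow> complex" where
    "g y = ((y $ 1 $ 1 - x $ 1 $ 1) * q $ 1 + (y $ 1 $ 2 - x $ 1 $ 2) * q $ 2) / - contract p q" for y
  have "X t $ 1 $ B - x $ 1 $ B = t * raise p $ B + t\<^sup>2 / 2 * raise q $ B" for t B
    by (simp add: X_def)
  moreover have "(t * raise p $ 1 + t\<^sup>2 / 2 * raise q $ 1) * q $ 1 +
      (t * raise p $ 2 + t\<^sup>2 / 2 * raise q $ 2) * q $ 2 = t * - contract p q" for t
    by (simp add: raise_def contract_eq algebra_simps)
  ultimately have gX: "g (X t) = t" for t
    using assms by (simp add: g_def)
  have "continuous_on UNIV g" unfolding g_def by (intro continuous_intros) (use assms in auto)
  then have "homeomorphism UNIV (range X) X g"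
    unfolding homeomorphism_def using gX holo_on_imp_continuous_on[OF hX]
    by (auto intro: continuous_on_subset simp: image_image)
  moreover have "velocity X t \<noteq> 0" for t
  proof
    assume "velocity X t = 0"
    then have "V t $ 1 $ B = 0" for B by (simp add: V)
    then have "raise (p + t *s q) $ B = 0" for B by (simp add: V_def)
    then have "p + t *s q = 0" by (rule raise_eq_0)
    then show False using nz by blast
  qed
  moreover have "det (velocity X t) = 0" for t by (simp add: V V_def det_2)
  ultimately have "null_curve X" using hX by (auto simp: null_curve_def)
  moreover have "X 0 = x" by (simp add: X_def vec_eq_iff)
  moreover have "velocity X t *v (p + t *s q) = 0" for t
    by (simp add: V V_def vec_eq_iff mv_spinor raise_def algebra_simps)
  ultimately show ?thesis using that by blast
qed

section \<open>Image curves and the nonsingular region\<close>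

context twistor_endomorphism
begin

lemma image_curve_lift:
  assumes X: "null_curve X"
    and p: "holo_on p U" "\<forall>t\<in>U. p t \<noteq> 0 \<and> velocity X t *v p t = 0" and s: "s \<in> U"
  defines "w \<equiv> \<lambda>t. F (twistor_at (X t) (p t))"
  shows "kappa X s = proj (twistor_at (X s) (p s))"
    and "curve_lift (ft \<circ> kappa X) U w"
    and "velocity w s = DF (twistor_at (X s) (p s)) (twistor_at (X s) (velocity p s))"
proof -
  have kappa: "kappa X t = proj (twistor_at (X t) (p t))" if "t \<in> U" for t
    using X p(2) that by (intro kappa_eq) (auto simp: null_curve_def)
  then show "kappa X s = proj (twistor_at (X s) (p s))" using s .
  have hX: "holo_on X U"
    using X holo_on_open[OF p(1)] by (auto simp: null_curve_def intro: holo_on_subset)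
  note hz = holo_on_twistor_at[OF hX p(1)]
  show "curve_lift (ft \<circ> kappa X) U w"
    unfolding curve_lift_def w_def
    using holo_on_F[OF hz] kappa p(2) twistor_at_nonzero by (auto simp: ft_proj)
  have "velocity w s = DF (twistor_at (X s) (p s)) (velocity (\<lambda>t. twistor_at (X t) (p t)) s)"
    unfolding w_def DF_def by (rule velocity_compose_holo[OF hz _ s holo_F]) simp
  then show "velocity w s = DF (twistor_at (X s) (p s)) (twistor_at (X s) (velocity p s))"
    using velocity_twistor_at[OF hX p(1) s] p(2) s by simp
qed

lemma nonsingular_null_curve:
  assumes "null_curve X" "nonsingular_at (ft \<circ> kappa X) s"
  obtains p q where "kappa X s = proj (twistor_at (X s) p)" "wronskian (X s) p q \<noteq> 0"
    "induced ft X s = image_point (X s) p q"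
proof -
  obtain U p where U: "s \<in> U" "holo_on p U" "\<forall>t\<in>U. p t \<noteq> 0 \<and> velocity X t *v p t = 0"
    using null_curve_kernel[OF assms(1)] by blast
  define w where "w = (\<lambda>t. F (twistor_at (X t) (p t)))"
  note l = image_curve_lift[OF assms(1) U(2,3,1), folded w_def]
  have ws: "w s = F (twistor_at (X s) (p s))" by (simp add: w_def)
  have "wronskian (X s) (p s) (velocity p s) \<noteq> 0"
    using assms(2) nonsingular_at_iff[OF l(2) U(1)] by (simp only: l(3) ws wronskian_def simp_thms)
  moreover from this have "induced ft X s = image_point (X s) (p s) (velocity p s)"
    using kappa_inv_eq[OF l(2) U(1)]
    by (simp only: l(3) ws wronskian_def induced_def image_point_def simp_thms)
  ultimately show ?thesis using that l(1) by blast
qed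

lemma exists_nonsingular_null_curve:
  assumes "wronskian x p q \<noteq> 0"
  obtains X where "null_curve X" "nonsingular_at (ft \<circ> kappa X) 0" "X 0 = x"
    "kappa X 0 = proj (twistor_at x p)"
proof -
  note nz = wronskian_nonzero_imp[OF assms]
  obtain X where X: "null_curve X" "X 0 = x" "\<And>t. velocity X t *v (p + t *s q) = 0"
    using exists_null_curve[OF nz(1)] by blast
  let ?p = "\<lambda>t. p + t *s q"
  have hp: "holo_on ?p UNIV"
    by (rule holo_on_component) (auto intro!: holo_intros)
  have p0: "?p t \<noteq> 0" for t
  proof
    assume "?p t = 0"
    then have "contract (?p t) q = 0" by simp
    then show False using nz(1) by (simp add: contract_add_left contract_scale_left)
  qed
  have "((\<lambda>t. ?p t $ i) has_field_derivative q $ i) (at 0)" for i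
    by (auto intro!: derivative_eq_intros)
  then have "velocity ?p 0 $ i = q $ i" for i
    using velocity_nth_has_field_derivative[OF hp UNIV_I] DERIV_unique by blast
  then have vp: "velocity ?p 0 = q" by (simp add: vec_eq_iff)
  have "\<forall>t\<in>UNIV. ?p t \<noteq> 0 \<and> velocity X t *v ?p t = 0" using p0 X(3) by blast
  note l = image_curve_lift[where s = 0, OF X(1) hp this UNIV_I]
  have "nonsingular_at (ft \<circ> kappa X) 0"
    using assms nonsingular_at_iff[OF l(2) UNIV_I]
    by (simp add: l(3) vp X(2) wronskian_def)
  then show ?thesis using that X(1,2) l(1) by simp
qed

text \<open>Given a null curve with nonsingular image, \<open>q\<close> is the velocity of a spinor
  lift; conversely the quadratic null curve realises any \<open>q\<close>. The quantifier over
  curves is thereby replaced by nonvanishing of holomorphic functions.\<close>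

lemma nonsingular_region_eq: "nonsingular_region ft = (\<lambda>(x, p). (x, proj p)) ` nonsingular_set"
proof (intro set_eqI iffI)
  fix u assume "u \<in> nonsingular_region ft"
  then obtain X s where X: "u = (X s, primed_class (kappa X s))"
    "null_curve X" "nonsingular_at (ft \<circ> kappa X) s"
    by (auto simp: nonsingular_region_def)
  obtain p q where pq: "kappa X s = proj (twistor_at (X s) p)" "wronskian (X s) p q \<noteq> 0"
    using nonsingular_null_curve[OF X(2,3)] by blast
  have "u = (X s, proj p)"
    using X(1) pq(1) primed_class_proj[of "twistor_at (X s) p"] wronskian_nonzero_imp(2)[OF pq(2)]
    by simp
  then show "u \<in> (\<lambda>(x, p). (x, proj p)) ` nonsingular_set"
    using pq(2) by (auto simp: nonsingular_set_def)
next
  fix u assume "u \<in> (\<lambda>(x, p). (x, proj p)) ` nonsingular_set"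
  then obtain x p q where u: "u = (x, proj p)" "wronskian x p q \<noteq> 0"
    by (auto simp: nonsingular_set_def)
  obtain X where "null_curve X" "nonsingular_at (ft \<circ> kappa X) 0" "X 0 = x"
    "kappa X 0 = proj (twistor_at x p)"
    using exists_nonsingular_null_curve[OF u(2)] by blast
  moreover have "primed_class (proj (twistor_at x p)) = proj p"
    using primed_class_proj[of "twistor_at x p"] wronskian_nonzero_imp(2)[OF u(2)] by simp
  ultimately show "u \<in> nonsingular_region ft"
    using u(1) unfolding nonsingular_region_def by force
qed

lemma nonsingular_set_nonzero: "(x, p) \<in> nonsingular_set \<Longrightarrow> p \<noteq> 0"
  using wronskian_nonzero_imp(2) by (auto simp: nonsingular_set_def)

lemma open_nonsingular_region: "open (nonsingular_region ft)"
  unfolding nonsingular_region_eq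
  by (rule open_image_Pair_proj[OF open_nonsingular_set nonsingular_set_nonzero])

lemma mem_nonsingular_region:
  assumes "p \<noteq> 0"
  shows "(x, proj p) \<in> nonsingular_region ft \<longleftrightarrow> (x, p) \<in> nonsingular_set"
proof
  assume "(x, proj p) \<in> nonsingular_region ft"
  then obtain q where q: "(x, q) \<in> nonsingular_set" "proj p = proj q"
    by (auto simp: nonsingular_region_eq)
  then obtain c where "c \<noteq> 0" "q = c *s p"
    using proj_eq_iff[OF assms nonsingular_set_nonzero[OF q(1)]] by blast
  then show "(x, p) \<in> nonsingular_set" using q(1) by (simp add: nonsingular_set_scale)
qed (auto simp: nonsingular_region_eq)

lemma arises_from_corr_map: "arises_from corr_map ft"
  unfolding arises_from_def
proof (intro allI impI)
  fix X s assume "null_curve X \<and> nonsingular_at (ft \<circ> kappa X) s"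
  then obtain p q where pq: "kappa X s = proj (twistor_at (X s) p)" "wronskian (X s) p q \<noteq> 0"
    "induced ft X s = image_point (X s) p q"
    using nonsingular_null_curve by blast
  note nz = wronskian_nonzero_imp[OF pq(2)]
  have "primed_class (kappa X s) = proj p"
    using pq(1) primed_class_proj[of "twistor_at (X s) p"] nz(2) by simp
  moreover have "primed_class (ft (kappa X s)) = proj (primed (F (twistor_at (X s) p)))"
    using pq(1) primed_class_proj[OF nz(3)] nz(2) by (simp add: ft_proj twistor_at_nonzero)
  ultimately show "corr_map (X s, primed_class (kappa X s)) =
      (induced ft X s, primed_class (ft (kappa X s)))"
    using corr_map_eq[OF pq(2)] pq(3) by simp
qed

end

section \<open>Density\<close>

text \<open>The class ties \<open>scaleC\<close> to the norm through real scalars only, so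
  boundedness of the map taking t to \<open>t *\<^sub>C v\<close> is obtained from the real and
  imaginary parts of t.\<close>

lemma scaleC_split: "t *\<^sub>C v = Re t *\<^sub>R v + Im t *\<^sub>R (\<i> *\<^sub>C v)"
proof -
  have "t *\<^sub>C v = (complex_of_real (Re t) + complex_of_real (Im t) * \<i>) *\<^sub>C v"
    by (metis complex_eq mult.commute)
  then show ?thesis by (metis scaleC_add_left scaleC_of_real scaleC_scaleC)
qed

lemma holo_on_line: "holo_on (\<lambda>t::complex. u + t *\<^sub>C v) UNIV"
proof (rule holo_on_add[OF holo_on_const[OF open_UNIV] holo_on_bounded_linear[OF _ _ open_UNIV]])
  show "bounded_linear (\<lambda>t::complex. t *\<^sub>C v)"
    by (subst scaleC_split) (intro bounded_linear_add bounded_linear_scaleR_const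
        bounded_linear_Re bounded_linear_Im)
qed (simp add: scaleC_scaleC)

text \<open>The complex line from \<open>u\<close> to \<open>v\<close> meets \<open>T\<close> in a
  nonempty open set of parameters. Were \<open>Q\<close> zero there, the identity theorem in one
  variable would make it zero at \<open>v\<close>.\<close>

lemma holo_nonzero_dense:
  fixes Q :: "'a::complex_space \<Rightarrow> complex"
  assumes "holo_on Q UNIV" "Q v \<noteq> 0" "open T" "u \<in> T"
  obtains w where "w \<in> T" "Q w \<noteq> 0"
proof (rule ccontr)
  assume "\<not> thesis"
  with that have zero: "Q w = 0" if "w \<in> T" for w using that by blast
  define g where "g t = u + t *\<^sub>C (v - u)" for t :: complex
  have g: "holo_on g UNIV" unfolding g_def by (rule holo_on_line)
  have "holo_on (\<lambda>t. Q (g t)) UNIV" by (rule holo_on_compose[OF g assms(1)]) simp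
  then have hol: "(\<lambda>t. Q (g t)) holomorphic_on UNIV" by (simp add: holo_on_complex_iff)
  have op: "open (g -` T)"
    by (rule open_vimage[OF assms(3) holo_on_imp_continuous_on[OF g]])
  have "g 0 = u"
    using scaleC_of_real[of 0 "v - u"] by (simp add: g_def)
  then have "g -` T \<noteq> {}" using assms(4) by auto
  have "Q (g 1) = 0"
    by (rule analytic_continuation_open[OF op open_UNIV \<open>g -` T \<noteq> {}\<close> connected_UNIV
          subset_UNIV hol holomorphic_on_const]) (simp_all add: zero)
  moreover have "g 1 = v" by (simp add: g_def)
  ultimately show False using assms(2) by simp
qed

lemma open_nonzero:
  fixes Q :: "'a::complex_space \<Rightarrow> complex"
  shows "holo_on Q UNIV \<Longrightarrow> open {u. Q u \<noteq> 0}"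
  using open_vimage[of "- {0}" Q] holo_on_imp_continuous_on[of Q UNIV]
  by (auto simp: vimage_def)

lemma holo_det:
  fixes A :: "'a::complex_space \<Rightarrow> complex^'n::finite^'n"
  assumes "open U" "\<And>i j. holo_on (\<lambda>u. A u $ i $ j) U"
  shows "holo_on (\<lambda>u. det (A u)) U"
  unfolding det_def
  by (intro holo_on_sum holo_on_prod holo_on_mult holo_on_const assms) simp_all

context twistor_endomorphism
begin

text \<open>The determinant is taken over the complex numbers, so injectivity of the derivative
  becomes nonvanishing of a holomorphic function of the twistor.\<close>

definition jacobian :: "twistor \<Rightarrow> complex" where
  "jacobian z = det (matrix (DF z))"

lemma linear_DF: "Vector_Spaces.linear (*s) (*s) (DF z)"
  by unfold_locales (simp_all add: DF_add DF_scale vector_add_ldistrib vector_sadd_rdistrib)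

lemma inj_DF_iff: "inj (DF z) \<longleftrightarrow> jacobian z \<noteq> 0"
proof -
  have "(*v) (matrix (DF z)) = DF z"
    using matrix_works[OF linear_DF] by (simp add: fun_eq_iff)
  then show ?thesis
    unfolding jacobian_def
    by (metis invertible_det_nz invertible_left_inverse matrix_left_invertible_injective)
qed

lemma holo_on_jacobian:
  assumes "holo_on f U"
  shows "holo_on (\<lambda>u. jacobian (f u)) U"
  unfolding jacobian_def
  by (intro holo_det holo_on_open[OF assms])
     (auto simp: matrix_def intro!: holo_on_vec_nth holo_on_DF assms holo_on_const holo_on_open[OF assms])

lemma surj_DF:
  assumes "jacobian z \<noteq> 0"
  obtains w where "DF z w = v"
proof -
  have "surj (DF z)"
    using assms bounded_linear.linear[OF bounded_linear_DF]
    by (simp add: inj_DF_iff[symmetric] linear_injective_imp_surjective)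
  then show ?thesis using that by (metis surjD)
qed

text \<open>If the primed part of F vanished on an open set, so would that of its derivative, which
  is impossible where the derivative is onto.\<close>

lemma primed_F_nonzero:
  assumes "open T" "z \<in> T" "jacobian z \<noteq> 0"
  obtains w where "w \<in> T" "primed (F w) \<noteq> 0"
proof (rule ccontr)
  assume "\<not> thesis"
  with that have zero: "primed (F w) = 0" if "w \<in> T" for w using that by blast
  have lin: "bounded_linear primed"
    unfolding primed_def vec_lambda_eq_sum_axis
    by (intro bounded_linear_sum bounded_linear_compose[OF bounded_linear_axis] bounded_linear_vec_nth)
  have "((\<lambda>z. primed (F z)) has_derivative (\<lambda>w. primed (DF z w))) (at z)"
    by (rule bounded_linear.has_derivative[OF lin has_derivative_F])
  moreover have "((\<lambda>z. primed (F z)) has_derivative (\<lambda>w. 0)) (at z)"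
    by (rule has_derivative_transform_within_open[OF has_derivative_const assms(1,2)])
       (simp add: zero)
  ultimately have "(\<lambda>w. primed (DF z w)) = (\<lambda>w. 0)" by (rule has_derivative_unique)
  moreover obtain w where "DF z w = twistor_at 0 (axis 1 1)" using surj_DF[OF assms(3)] by blast
  ultimately have "axis 1 1 = (0 :: spinor)" by (metis primed_twistor_at)
  then show False by (simp add: axis_eq_0_iff)
qed

text \<open>The point \<open>x\<close> is determined last, as the one incident with a good twistor
  \<open>z\<close> and a generic second twistor \<open>w\<close>. The conditions on each are imposed
  one after another, within an open set on which the earlier ones persist.\<close>

lemma exists_regular:
  obtains x p q where "wronskian x p q \<noteq> 0" "jacobian (twistor_at x p) \<noteq> 0"
proof -
  have "\<exists>z. inj (frechet_derivative F (at z))"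
    by (rule exists_injective_derivative[OF _ homogeneous_F]) (use d_pos in auto)
  then obtain z1 where z1: "jacobian z1 \<noteq> 0"
    using inj_DF_iff by (auto simp: DF_def)
  have oj: "open {z. jacobian z \<noteq> 0}"
    by (rule open_nonzero[OF holo_on_jacobian[OF holo_on_id[OF open_UNIV]]])
  obtain z2 where z2: "jacobian z2 \<noteq> 0" "primed (F z2) \<noteq> 0"
    using primed_F_nonzero[OF oj _ z1] z1 by blast
  then obtain i where i: "primed (F z2) $ i \<noteq> 0" by (auto simp: vec_eq_iff)
  have "holo_on (\<lambda>z. primed (F z) $ i) UNIV"
    by (intro holo_on_vec_nth holo_on_primed holo_F)
  from open_Int[OF oj open_nonzero[OF this]]
  have T: "open ({z. jacobian z \<noteq> 0} \<inter> {z. primed (F z) $ i \<noteq> 0})" .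
  have h1: "holo_on (\<lambda>z. primed z $ 1) UNIV"
    by (intro holo_on_vec_nth holo_on_primed holo_on_id open_UNIV)
  have "primed (twistor_at 0 (axis 1 1)) $ 1 \<noteq> 0" by (simp add: axis_def)
  from holo_nonzero_dense[OF h1 this T, of z2]
  obtain z where z: "jacobian z \<noteq> 0" "primed (F z) $ i \<noteq> 0" "primed z $ 1 \<noteq> 0"
    using z2 i by auto
  have "primed (F z) \<noteq> 0" "primed z \<noteq> 0" using z(2,3) by auto
  obtain q1 where q1: "contract (primed (F z)) q1 \<noteq> 0"
    using \<open>primed (F z) \<noteq> 0\<close> by (rule exists_contract_nonzero)
  \<comment> \<open>A preimage of a twistor with primed part \<open>q1\<close> shows that a nonzero
    Wronskian is possible for this \<open>z\<close>; by density it then occurs inside the open set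
    where \<open>z\<close> and \<open>w\<close> have independent primed parts.\<close>
  obtain w1 where w1: "DF z w1 = twistor_at 0 q1" using surj_DF[OF z(1)] by blast
  obtain q2 where q2: "contract (primed z) q2 \<noteq> 0"
    using \<open>primed z \<noteq> 0\<close> by (rule exists_contract_nonzero)
  have ha: "holo_on (\<lambda>w. contract (primed (F z)) (primed (DF z w))) UNIV"
    and hb: "holo_on (\<lambda>w. contract (primed z) (primed w)) UNIV"
    by (intro holo_on_contract holo_on_const holo_on_primed holo_on_DF holo_on_id open_UNIV)+
  obtain w where w: "contract (primed (F z)) (primed (DF z w)) \<noteq> 0" "contract (primed z) (primed w) \<noteq> 0"
    using holo_nonzero_dense[OF ha _ open_nonzero[OF hb], of w1 "twistor_at 0 q2"] q1 q2
    by (auto simp: w1)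
  define x where "x = twistor_point z w"
  have "twistor_at x (primed z) = z" "twistor_at x (primed w) = w"
    using incident_twistor_point[OF w(2)] by (simp_all add: x_def incident_iff)
  then have "wronskian x (primed z) (primed w) \<noteq> 0" "jacobian (twistor_at x (primed z)) \<noteq> 0"
    using w(1) z(1) by (simp_all add: wronskian_def)
  then show ?thesis by (rule that)
qed

section \<open>Openness and density of the regular region\<close>

definition regular_set :: "(point \<times> spinor) set" where
  "regular_set = nonsingular_set \<inter> {(x, p). jacobian (twistor_at x p) \<noteq> 0}"

lemma jacobian_scale:
  assumes "c \<noteq> 0"
  shows "jacobian (c *s z) = 0 \<longleftrightarrow> jacobian z = 0"
proof -
  have "inj (DF (c *s z)) \<longleftrightarrow> inj (DF z)"
    using assms by (auto simp: inj_def DF_homogeneous[OF assms] vector_mul_lcancel)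
  then show ?thesis by (simp add: inj_DF_iff)
qed

lemma regular_region_eq: "regular_region F ft = (\<lambda>(x, p). (x, proj p)) ` regular_set"
proof (intro set_eqI iffI)
  fix u assume "u \<in> regular_region F ft"
  then obtain x z where u: "u = (x, proj (primed z))" "(x, proj (primed z)) \<in> nonsingular_region ft"
    "z \<noteq> 0" "incident x z" "inj (DF z)"
    by (auto simp: regular_region_def DF_def)
  have z: "z = twistor_at x (primed z)" using u(4) by (simp add: incident_iff)
  then have "primed z \<noteq> 0" using u(3) by (metis twistor_at_zero)
  then have "(x, primed z) \<in> regular_set"
    using u(2,5) z by (simp add: regular_set_def mem_nonsingular_region inj_DF_iff)
  then show "u \<in> (\<lambda>(x, p). (x, proj p)) ` regular_set" using u(1) by force
next
  fix u assume "u \<in> (\<lambda>(x, p). (x, proj p)) ` regular_set"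
  then obtain x p where u: "u = (x, proj p)" "(x, p) \<in> nonsingular_set" "inj (DF (twistor_at x p))"
    by (auto simp: regular_set_def inj_DF_iff)
  then have p: "p \<noteq> 0" using nonsingular_set_nonzero by blast
  have "u \<in> nonsingular_region ft" using u p by (simp add: mem_nonsingular_region)
  moreover have "u = (x, proj (primed (twistor_at x p)))" using u by simp
  moreover have "twistor_at x p \<noteq> 0" "incident x (twistor_at x p)"
    using p twistor_at_nonzero by auto
  ultimately show "u \<in> regular_region F ft"
    using u(3) unfolding regular_region_def DF_def by blast
qed

lemma holo_jacobian_twistor_at: "holo_on (\<lambda>u. jacobian (twistor_at (fst u) (snd u))) UNIV"
  by (intro holo_on_jacobian holo_on_twistor_at holo_on_fst holo_on_snd holo_on_id open_UNIV)

lemma open_regular_region: "open (regular_region F ft)"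
  unfolding regular_region_eq
proof (rule open_image_Pair_proj)
  have "{(x, p). jacobian (twistor_at x p) \<noteq> 0} = {u. jacobian (twistor_at (fst u) (snd u)) \<noteq> 0}"
    by auto
  then show "open regular_set"
    unfolding regular_set_def
    using open_nonsingular_set open_nonzero[OF holo_jacobian_twistor_at] by (simp add: open_Int)
qed (auto simp: regular_set_def dest: nonsingular_set_nonzero)

lemma mem_regular_region:
  assumes "p \<noteq> 0"
  shows "(x, proj p) \<in> regular_region F ft \<longleftrightarrow>
    (x, p) \<in> nonsingular_set \<and> jacobian (twistor_at x p) \<noteq> 0"
proof
  assume "(x, proj p) \<in> regular_region F ft"
  then obtain q where q: "(x, q) \<in> nonsingular_set" "jacobian (twistor_at x q) \<noteq> 0" "proj p = proj q"
    by (auto simp: regular_region_eq regular_set_def)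
  then obtain c where "c \<noteq> 0" "q = c *s p"
    using proj_eq_iff[OF assms nonsingular_set_nonzero[OF q(1)]] by blast
  then show "(x, p) \<in> nonsingular_set \<and> jacobian (twistor_at x p) \<noteq> 0"
    using q(1,2) by (simp add: nonsingular_set_scale twistor_at_scale jacobian_scale)
qed (auto simp: regular_region_eq regular_set_def)

text \<open>One regular pair makes the product of Wronskian and Jacobian a nonzero holomorphic
  function on the vector space of pairs (x, p), so every open set meets the region. The direction
  \<open>q1\<close> can stay fixed, since nonvanishing for this one direction already implies
  nonsingularity.\<close>

lemma closure_regular_region: "closure (regular_region F ft) = UNIV"
proof (rule ccontr)
  define T where "T = - closure (regular_region F ft)"
  assume "closure (regular_region F ft) \<noteq> UNIV"
  then obtain x a where xa: "(x, a) \<in> T" by (auto simp: T_def)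
  obtain p where p: "p \<noteq> 0" "a = proj p" using rep_proj_nonzero proj_rep_proj by metis
  obtain x1 p1 q1 where r: "wronskian x1 p1 q1 \<noteq> 0" "jacobian (twistor_at x1 p1) \<noteq> 0"
    by (rule exists_regular)
  have "open T" by (simp add: T_def open_Compl)
  from open_vimage_Pair_proj[OF this]
  have T': "open {(y, q). q \<noteq> 0 \<and> (y, proj q) \<in> T}" .
  have h: "holo_on (\<lambda>u. wronskian (fst u) (snd u) q1 * jacobian (twistor_at (fst u) (snd u))) UNIV"
    by (intro holo_on_mult holo_wronskian holo_jacobian_twistor_at)
  obtain u where u: "u \<in> {(y, q). q \<noteq> 0 \<and> (y, proj q) \<in> T}"
    "wronskian (fst u) (snd u) q1 * jacobian (twistor_at (fst u) (snd u)) \<noteq> 0"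
    using holo_nonzero_dense[OF h _ T', of "(x1, p1)" "(x, p)"] r xa p by auto
  then obtain y q where yq: "u = (y, q)" "q \<noteq> 0" "(y, proj q) \<in> T"
    "(y, q) \<in> nonsingular_set" "jacobian (twistor_at y q) \<noteq> 0"
    by (cases u) (auto simp: nonsingular_set_def)
  then have "(y, proj q) \<in> regular_region F ft" by (simp add: mem_regular_region)
  then show False using yq(3) closure_subset by (auto simp: T_def)
qed

lemma closure_nonsingular_region: "closure (nonsingular_region ft) = UNIV"
proof -
  have "regular_region F ft \<subseteq> nonsingular_region ft" by (auto simp: regular_region_def)
  then show ?thesis using closure_mono closure_regular_region by blast
qed

end

section \<open>Self-dual surfaces\<close>

lemma norm_smult: "norm (c *s (v :: complex^'n::finite)) = cmod c * norm v"
  by (simp add: norm_vec_def norm_mult L2_set_right_distrib)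

lemma line_has_field_derivative:
  fixes f :: "complex^'n::finite \<Rightarrow> complex"
  assumes "holo_on f U" "u + t *s v \<in> U"
  shows "((\<lambda>t. f (u + t *s v)) has_field_derivative frechet_derivative f (at (u + t *s v)) v) (at t)"
proof -
  note d = holo_on_derivative[OF assms]
  have "((\<lambda>t. u + t *s v) has_derivative (\<lambda>t. t *s v)) (at t)"
  proof -
    have "((\<lambda>t. \<chi> j. u $ j + t * v $ j) has_derivative (\<lambda>t. \<chi> j. t * v $ j)) (at t)"
      by (rule has_derivative_vec_lambda) (auto intro!: derivative_eq_intros)
    then show ?thesis by (simp add: vector_scalar_mult_def plus_vec_def)
  qed
  from has_derivative_compose[OF this d(1)] show ?thesis
    using d(2)[unfolded scaleC_vec_eq]
    unfolding has_field_derivative_def by (simp add: mult_commute_abs)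
qed

text \<open>The directional derivatives at \<open>u\<close> and \<open>u0\<close> differ by the
  derivative at 0 of the difference of \<open>f\<close> along two parallel complex lines. Uniform
  continuity makes this difference small on a circle, and Cauchy's inequality bounds its
  derivative.\<close>

lemma holo_on_partial_continuous:
  fixes f :: "complex^'n::finite \<Rightarrow> complex"
  assumes f: "holo_on f U"
  shows "continuous_on U (\<lambda>u. frechet_derivative f (at u) v)"
  unfolding continuous_on_iff
proof (intro ballI allI impI)
  fix u0 :: "complex^'n" and e :: real assume u0: "u0 \<in> U" and e: "e > 0"
  obtain \<rho> where \<rho>: "\<rho> > 0" "cball u0 \<rho> \<subseteq> U"
    using open_contains_cball holo_on_open[OF f] u0 by blast
  \<comment> \<open>With this radius both lines stay in the closed ball when \<open>u\<close> is
    within \<rho> / 2 of \<open>u0\<close>; the added 1 covers \<open>v\<close> = 0.\<close>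
  define r where "r = \<rho> / (2 * (norm v + 1))"
  have nv: "norm v + 1 > 0" using norm_ge_zero[of v] by linarith
  have r: "r > 0" using \<rho>(1) nv by (simp add: r_def)
  have "r * norm v \<le> r * (norm v + 1)" using r by simp
  also have "\<rho> / (2 * k) * k = \<rho> / 2" if "k > 0" for k :: real using that by simp
  from this[OF nv] have "r * (norm v + 1) = \<rho> / 2" by (simp only: r_def)
  finally have rv: "r * norm v \<le> \<rho> / 2" .
  have "uniformly_continuous_on (cball u0 \<rho>) f"
    using continuous_on_subset[OF holo_on_imp_continuous_on[OF f] \<rho>(2)]
    by (simp add: compact_uniformly_continuous)
  then obtain \<delta> where \<delta>: "\<delta> > 0" "\<And>x y. x \<in> cball u0 \<rho> \<Longrightarrow> y \<in> cball u0 \<rho> \<Longrightarrow> dist y x < \<delta> \<Longrightarrow>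
      dist (f y) (f x) < e * r / 2"
    using e r unfolding uniformly_continuous_on_def by (metis half_gt_zero mult_pos_pos)
  show "\<exists>d>0. \<forall>u\<in>U. dist u u0 < d \<longrightarrow>
      dist (frechet_derivative f (at u) v) (frechet_derivative f (at u0) v) < e"
  proof (intro exI[of _ "min \<delta> (\<rho> / 2)"] conjI ballI impI)
    fix u assume u: "u \<in> U" "dist u u0 < min \<delta> (\<rho> / 2)"
    have line: "x + t *s v \<in> cball u0 \<rho>" if "dist x u0 \<le> \<rho> / 2" "cmod t \<le> r" for x t
    proof -
      have "dist u0 (x + t *s v) \<le> dist u0 x + dist x (x + t *s v)" by (rule dist_triangle)
      also have "dist x (x + t *s v) = cmod t * norm v" by (simp add: dist_norm norm_smult)
      also have "\<dots> \<le> r * norm v" using that(2) by (intro mult_right_mono) auto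
      finally show ?thesis using that(1) rv by (simp add: dist_commute)
    qed
    define g where "g t = f (u + t *s v) - f (u0 + t *s v)" for t
    define g' where "g' t = frechet_derivative f (at (u + t *s v)) v
        - frechet_derivative f (at (u0 + t *s v)) v" for t
    have g: "(g has_field_derivative g' t) (at t)" if "cmod t \<le> r" for t
      unfolding g_def g'_def using line[OF _ that] u(2) \<rho> that
      by (intro DERIV_diff line_has_field_derivative[OF f]) auto
    \<comment> \<open>The tolerance e r / 2 on the circle leaves e / 2 after division by the
      radius.\<close>
    have "norm ((deriv ^^ 1) g 0) \<le> fact 1 * (e * r / 2) / r ^ 1"
    proof (rule Cauchy_inequality)
      have "t \<in> ball 0 r \<Longrightarrow> \<exists>D. (g has_field_derivative D) (at t)" for t
        using g[of t] by auto
      then show "g holomorphic_on ball 0 r" by (auto simp: holomorphic_on_open)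
      show "continuous_on (cball 0 r) g"
        by (intro continuous_at_imp_continuous_on ballI) (rule DERIV_isCont[OF g], simp)
      show "norm (g t) \<le> e * r / 2" if "norm (0 - t) = r" for t
      proof -
        have "dist (u + t *s v) (u0 + t *s v) < \<delta>" using u(2) by simp
        then have "dist (f (u + t *s v)) (f (u0 + t *s v)) < e * r / 2"
          using \<delta>(2) line that u(2) \<rho>(1) by auto
        then show ?thesis by (simp add: g_def dist_norm)
      qed
    qed fact
    then have "norm (g' 0) \<le> e / 2"
      using DERIV_imp_deriv[OF g[of 0]] r by simp
    then show "dist (frechet_derivative f (at u) v) (frechet_derivative f (at u0) v) < e"
      using e by (simp add: g'_def dist_norm)
  qed (use \<delta>(1) \<rho>(1) in auto)
qed

lemma frechet_derivative_nth:
  fixes f :: "'a::complex_space \<Rightarrow> complex^'m::finite"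
  assumes "holo_on f U" "u \<in> U"
  shows "frechet_derivative f (at u) v $ i = frechet_derivative (\<lambda>u. f u $ i) (at u) v"
proof -
  have "((\<lambda>u. f u $ i) has_derivative (\<lambda>v. frechet_derivative f (at u) v $ i)) (at u)"
    by (rule bounded_linear.has_derivative[OF bounded_linear_vec_nth holo_on_derivative(1)[OF assms]])
  from frechet_derivative_at[OF this] show ?thesis by metis
qed

lemma holo_on_derivative_continuous:
  fixes f :: "complex^'n::finite \<Rightarrow> complex^'m::finite"
  assumes "holo_on f U"
  shows "continuous_on U (\<lambda>u. frechet_derivative f (at u) v)"
proof -
  have "continuous_on U (\<lambda>u. \<chi> i. frechet_derivative (\<lambda>u. f u $ i) (at u) v)"
    by (intro continuous_on_vec_lambda holo_on_partial_continuous holo_on_vec_nth assms)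
  then show ?thesis
    by (rule continuous_on_eq) (simp add: vec_eq_iff frechet_derivative_nth[OF assms])
qed

text \<open>A map of \<open>\<complex>\<^sup>2\<close> whose derivative is a multiple \<open>m\<close> of the identity at every point has
  components depending on one variable each, so \<open>m\<close> depends on neither variable.\<close>

lemma homothetic_derivative_locally_constant:
  fixes \<phi> :: "complex^2 \<Rightarrow> complex^2"
  assumes V: "open V" "y0 \<in> V"
    and d: "\<And>y. y \<in> V \<Longrightarrow> (\<phi> has_derivative (\<lambda>v. m y *s v)) (at y)"
    and m0: "m y0 = 0"
  obtains r where "r > 0" "\<And>y. y \<in> ball y0 r \<Longrightarrow> \<phi> y = \<phi> y0"
proof -
  obtain R where R: "R > 0" "ball y0 R \<subseteq> V" using V open_contains_ball by blast
  \<comment> \<open>The norm is at most the sum of the two coordinate norms, so the product of two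
    discs of radius R / 2 lies in the ball of radius R.\<close>
  define r where "r = R / 2"
  have r: "r > 0" using R by (simp add: r_def)
  define P :: "complex \<Rightarrow> complex \<Rightarrow> complex^2" where "P s t = (\<chi> i. if i = 1 then s else t)" for s t
  let ?B1 = "ball (y0 $ 1) r" and ?B2 = "ball (y0 $ 2) r"
  have PV: "P s t \<in> V" if "s \<in> ?B1" "t \<in> ?B2" for s t
  proof -
    have "norm (y0 - P s t) \<le> (\<Sum>i\<in>UNIV. norm ((y0 - P s t) $ i))"
      unfolding norm_vec_def by (rule L2_set_le_sum) simp
    also have "\<dots> < R" using that by (simp add: sum_2 P_def dist_norm r_def)
    finally show ?thesis using R(2) by (auto simp: dist_norm)
  qed
  have P: "P (y $ 1) (y $ 2) = y" for y by (simp add: P_def spinor_eq_iff)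
  have d1: "((\<lambda>s. \<phi> (P s t) $ i) has_field_derivative (if i = 1 then m (P s t) else 0)) (at s)"
    and d2: "((\<lambda>t. \<phi> (P s t) $ i) has_field_derivative (if i = 1 then 0 else m (P s t))) (at t)"
    if "s \<in> ?B1" "t \<in> ?B2" for s t i
  proof -
    note dP = d[OF PV[OF that]]
    have ifd: "((\<lambda>x. if b then x else k) has_derivative (\<lambda>v. if b then v else 0)) (at z)"
      "((\<lambda>x. if b then k else x) has_derivative (\<lambda>v. if b then 0 else v)) (at z)"
      for b k and z :: complex by (cases b; simp)+
    have "((\<lambda>s. P s t) has_derivative (\<lambda>h. \<chi> i. if i = 1 then h else 0)) (at s)"
      unfolding P_def by (intro has_derivative_vec_lambda ifd)
    from bounded_linear.has_derivative[OF bounded_linear_vec_nth[of i] has_derivative_compose[OF this dP]]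
    show "((\<lambda>s. \<phi> (P s t) $ i) has_field_derivative (if i = 1 then m (P s t) else 0)) (at s)"
      unfolding has_field_derivative_def by (cases "i = 1") (simp_all add: lambda_zero)
    have "((\<lambda>t. P s t) has_derivative (\<lambda>h. \<chi> i. if i = 1 then 0 else h)) (at t)"
      unfolding P_def by (intro has_derivative_vec_lambda ifd)
    from bounded_linear.has_derivative[OF bounded_linear_vec_nth[of i] has_derivative_compose[OF this dP]]
    show "((\<lambda>t. \<phi> (P s t) $ i) has_field_derivative (if i = 1 then 0 else m (P s t))) (at t)"
      unfolding has_field_derivative_def by (cases "i = 1") (simp_all add: lambda_zero)
  qed
  have const: "h t = h t'" if "\<And>t. t \<in> ball c r \<Longrightarrow> (h has_field_derivative 0) (at t)"
    "t \<in> ball c r" "t' \<in> ball c r" for h :: "complex \<Rightarrow> complex" and c t t'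
    using has_field_derivative_0_imp_constant_on[of "ball c r" h] that
    by (auto simp: constant_on_def)
  have c1: "\<phi> (P s t) $ 1 = \<phi> (P s t') $ 1" if "s \<in> ?B1" "t \<in> ?B2" "t' \<in> ?B2" for s t t'
    by (rule const[of "y0 $ 2"]) (use d2[of s _ 1] that in auto)
  have c2: "\<phi> (P s t) $ 2 = \<phi> (P s' t) $ 2" if "s \<in> ?B1" "s' \<in> ?B1" "t \<in> ?B2" for s s' t
    by (rule const[of "y0 $ 1" "\<lambda>s. \<phi> (P s t) $ 2"]) (use d1[of _ t 2] that in auto)
  have m1: "m (P s t) = m (P s t')" if st: "s \<in> ?B1" "t \<in> ?B2" "t' \<in> ?B2" for s t t'
  proof -
    have "((\<lambda>s. \<phi> (P s t) $ 1) has_field_derivative m (P s t)) (at s)"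
      using d1[OF st(1,2), of 1] by simp
    then have "((\<lambda>s. \<phi> (P s t') $ 1) has_field_derivative m (P s t)) (at s)"
      by (rule has_field_derivative_transform_within_open[OF _ open_ball st(1)]) (rule c1[OF _ st(2,3)])
    moreover have "((\<lambda>s. \<phi> (P s t') $ 1) has_field_derivative m (P s t')) (at s)"
      using d1[OF st(1,3), of 1] by simp
    ultimately show ?thesis by (rule DERIV_unique)
  qed
  have m2: "m (P s t) = m (P s' t)" if st: "s \<in> ?B1" "s' \<in> ?B1" "t \<in> ?B2" for s s' t
  proof -
    have "((\<lambda>t. \<phi> (P s t) $ 2) has_field_derivative m (P s t)) (at t)"
      using d2[OF st(1,3), of 2] by simp
    then have "((\<lambda>t. \<phi> (P s' t) $ 2) has_field_derivative m (P s t)) (at t)"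
      by (rule has_field_derivative_transform_within_open[OF _ open_ball st(3)]) (rule c2[OF st(1,2)])
    moreover have "((\<lambda>t. \<phi> (P s' t) $ 2) has_field_derivative m (P s' t)) (at t)"
      using d2[OF st(2,3), of 2] by simp
    ultimately show ?thesis by (rule DERIV_unique)
  qed
  have y0B: "y0 $ 1 \<in> ?B1" "y0 $ 2 \<in> ?B2" using r by auto
  have m: "m (P s t) = 0" if "s \<in> ?B1" "t \<in> ?B2" for s t
    using m1[OF that y0B(2)] m2[OF that(1) y0B] m0 P by simp
  have "\<phi> y = \<phi> y0" if y: "y \<in> ball y0 r" for y
  proof -
    have yB: "y $ 1 \<in> ?B1" "y $ 2 \<in> ?B2"
      using y Finite_Cartesian_Product.norm_nth_le[of "y0 - y"]
      by (auto simp: dist_norm intro: le_less_trans)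
    have D1: "((\<lambda>s. \<phi> (P s (y $ 2)) $ i) has_field_derivative 0) (at s)" if "s \<in> ?B1" for s i
      using d1[OF that yB(2), of i] m[OF that yB(2)] by (cases "i = 1") simp_all
    have D2: "((\<lambda>t. \<phi> (P (y0 $ 1) t) $ i) has_field_derivative 0) (at t)" if "t \<in> ?B2" for t i
      using d2[OF y0B(1) that, of i] m[OF y0B(1) that] by (cases "i = 1") simp_all
    have "\<phi> (P (y $ 1) (y $ 2)) $ i = \<phi> (P (y0 $ 1) (y $ 2)) $ i" for i
      by (rule const[OF D1 yB(1) y0B(1)])
    moreover have "\<phi> (P (y0 $ 1) (y $ 2)) $ i = \<phi> (P (y0 $ 1) (y0 $ 2)) $ i" for i
      by (rule const[OF D2 yB(2) y0B(2)])
    ultimately show ?thesis by (simp add: vec_eq_iff P)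
  qed
  then show ?thesis using that r by blast
qed

section \<open>Affine alpha-planes as surfaces\<close>

text \<open>These are the points incident with the twistor of primed part \<open>p\<close> and
  \<open>omega\<close> part i w; the factor i is left out of \<open>w\<close>.\<close>

definition alpha_plane :: "spinor \<Rightarrow> spinor \<Rightarrow> point set" where
  "alpha_plane p w = {x. x *v p = w}"

text \<open>Such matrices annihilate \<open>p\<close>, as a spinor contracts with itself to zero;
  for \<open>p\<close> nonzero they are all the tangent vectors of its alpha-plane.\<close>

definition outer :: "spinor \<Rightarrow> spinor \<Rightarrow> point" where
  "outer a p = (\<chi> A B. a $ A * raise p $ B)"

lemma outer_mv: "outer a p *v q = contract q p *s a"
  by (simp add: outer_def vec_eq_iff mv_spinor raise_def contract_eq algebra_simps)

lemma bounded_linear_mv: "bounded_linear (\<lambda>x :: point. x *v p)"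
  by (intro linear_conv_bounded_linear[THEN iffD1] linearI)
     (simp_all add: vec_eq_iff mv_spinor algebra_simps scaleR_right_diff_distrib)

lemma scaleC_mv: "(c *\<^sub>C x) *v p = c *\<^sub>C (x *v (p :: spinor))"
  by (simp add: vec_eq_iff mv_spinor algebra_simps)

lemma mv_smult: "(x :: point) *v (c *s p) = c *s (x *v p)"
  by (simp add: vec_eq_iff mv_spinor algebra_simps)

lemma holo_on_mv:
  fixes f :: "'a::complex_space \<Rightarrow> point"
  shows "holo_on f U \<Longrightarrow> holo_on (\<lambda>u. f u *v (p :: spinor)) U"
  by (rule holo_on_bounded_linear_compose[OF bounded_linear_mv scaleC_mv])

lemma frechet_derivative_mv:
  fixes \<sigma> :: "'a::complex_space \<Rightarrow> point"
  assumes "holo_on \<sigma> U" "u \<in> U"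
  shows "frechet_derivative (\<lambda>u. \<sigma> u *v p) (at u) = (\<lambda>v. frechet_derivative \<sigma> (at u) v *v p)"
  using bounded_linear.has_derivative[OF bounded_linear_mv holo_on_derivative(1)[OF assms]]
  by (rule frechet_derivative_at[symmetric])

lemma continuous_on_mv:
  fixes f :: "'a::topological_space \<Rightarrow> point"
  shows "continuous_on U f \<Longrightarrow> continuous_on U (\<lambda>u. f u *v (p :: spinor))"
  by (rule bounded_linear.continuous_on[OF bounded_linear_mv])

text \<open>Contraction with a spinor \<open>q\<close> independent of \<open>p\<close> is injective
  on the alpha-plane with values in the space of the source, where ordinary invariance of domain
  applies. Its preimages restore openness relative to the plane.\<close>

lemma plane_invariance_of_domain:
  fixes f :: "complex^2 \<Rightarrow> point"
  assumes "open U" "continuous_on U f" "inj_on f U" "p \<noteq> 0" "f ` U \<subseteq> alpha_plane p w"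
  shows "openin (top_of_set (alpha_plane p w)) (f ` U)"
proof -
  obtain q where q: "contract p q \<noteq> 0" using assms(4) by (rule exists_contract_nonzero)
  define g where "g u = f u *v q" for u
  have eqI: "x = y" if "x \<in> alpha_plane p w" "y \<in> alpha_plane p w" "x *v q = y *v q" for x y
    using that by (intro mv_basis_eqI[OF _ _ q]) (simp_all add: alpha_plane_def)
  have "continuous_on U g" unfolding g_def by (rule continuous_on_mv[OF assms(2)])
  moreover have "inj_on g U"
  proof (rule inj_onI)
    fix u v assume "u \<in> U" "v \<in> U" "g u = g v"
    then have "f u = f v" using eqI assms(5) by (metis g_def image_subset_iff)
    then show "u = v" using \<open>u \<in> U\<close> \<open>v \<in> U\<close> assms(3) by (meson inj_onD)
  qed
  ultimately have "open (g ` U)" using assms(1) invariance_of_domain by blast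
  then have "open ((\<lambda>x. x *v q) -` (g ` U))"
    by (rule open_vimage[OF _ continuous_on_mv[OF continuous_on_id]])
  moreover have "f ` U = alpha_plane p w \<inter> (\<lambda>x. x *v q) -` (g ` U)"
    using assms(5) eqI by (auto simp: g_def)
  ultimately show ?thesis unfolding openin_open by blast
qed

text \<open>A single outer product with \<open>p\<close> suffices to compare the spinors. That the
  directions determine the spinor up to scale makes \<open>tangent_alpha\<close> well
  defined.\<close>

lemma alpha_directions_subset:
  assumes "p \<noteq> 0" "q \<noteq> 0" "alpha_directions p \<subseteq> alpha_directions q"
  obtains c where "c \<noteq> 0" "q = c *s p"
proof -
  have "outer (axis 1 1) p \<in> alpha_directions p" by (simp add: alpha_directions_def outer_mv)
  then have "outer (axis 1 1) p \<in> alpha_directions q" using assms(3) by blast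
  then have "contract q p = 0" by (auto simp: alpha_directions_def outer_mv axis_eq_0_iff)
  then have "contract p q = 0" by (simp add: contract_eq algebra_simps)
  then obtain c where "q = c *s p" by (rule contract_eq_0_imp_scale[OF assms(1)])
  moreover from this have "c \<noteq> 0" using assms(2) by auto
  ultimately show ?thesis using that by blast
qed

lemma alpha_directions_scale: "c \<noteq> 0 \<Longrightarrow> alpha_directions (c *s p) = alpha_directions p"
  by (auto simp: alpha_directions_def mv_smult)

lemma tangent_alpha_eq:
  assumes "p \<noteq> 0" "tangent_plane S x = alpha_directions p"
  shows "tangent_alpha S x = proj p"
  unfolding tangent_alpha_def
proof (rule the_equality)
  fix a assume "\<exists>q. q \<noteq> 0 \<and> a = proj q \<and> tangent_plane S x = alpha_directions q"
  then obtain q where q: "q \<noteq> 0" "a = proj q" "alpha_directions p \<subseteq> alpha_directions q"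
    using assms(2) by blast
  obtain c where "c \<noteq> 0" "q = c *s p" by (rule alpha_directions_subset[OF assms(1) q(1,3)])
  then show "a = proj p" using assms(1) q(2) by simp
qed (use assms in blast)

lemma derivative_in_alpha_directions:
  fixes \<sigma> :: "complex^2 \<Rightarrow> point"
  assumes "holo_on \<sigma> U" "\<And>u. u \<in> U \<Longrightarrow> \<sigma> u *v p = w" "u \<in> U"
  shows "frechet_derivative \<sigma> (at u) v *v p = 0"
proof -
  have "((\<lambda>u. \<sigma> u *v p) has_derivative (\<lambda>v. 0)) (at u)"
    by (rule has_derivative_transform_within_open[OF has_derivative_const
          holo_on_open[OF assms(1)] assms(3)]) (simp add: assms(2))
  from frechet_derivative_at[OF this] frechet_derivative_mv[OF assms(1,3), of p]
  show ?thesis by metis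
qed

text \<open>One affine chart covers the whole set, its inverse being a contraction with
  \<open>q\<close>. As \<open>tangent_plane\<close> collects directions from all charts, one
  inclusion treats an arbitrary chart: it maps into the plane, so its derivative annihilates
  \<open>p\<close>.\<close>

lemma alpha_plane_surface:
  assumes p: "p \<noteq> 0" and S: "openin (top_of_set (alpha_plane p w)) S" "S \<noteq> {}" "connected S"
  shows "self_dual_surface S" and "\<And>x. x \<in> S \<Longrightarrow> tangent_plane S x = alpha_directions p"
proof -
  obtain q where "contract p q \<noteq> 0" using p by (rule exists_contract_nonzero)
  then have q: "contract q p \<noteq> 0" "contract p q \<noteq> 0" by (simp_all add: contract_eq algebra_simps)
  obtain T where T: "open T" "S = alpha_plane p w \<inter> T" using S(1) by (auto simp: openin_open)
  obtain x0 where x0: "x0 \<in> S" using S(2) by blast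
  define \<sigma> where "\<sigma> u = x0 + outer u p" for u
  define U where "U = \<sigma> -` T"
  define g where "g x = (1 / contract q p) *s ((x - x0) *v q)" for x
  have x0w: "x0 *v p = w" using x0 T(2) by (simp add: alpha_plane_def)
  have holo\<sigma>: "holo_on \<sigma> V" if "open V" for V
    unfolding \<sigma>_def outer_def
    by (intro holo_on_add holo_on_const that holo_on_component)
       (auto intro!: holo_intros that)
  have D\<sigma>: "frechet_derivative \<sigma> (at u) = (\<lambda>v. outer v p)" for u
  proof -
    have "bounded_linear (\<lambda>v. outer v p)"
      by (intro linear_conv_bounded_linear[THEN iffD1] linearI)
         (simp_all add: outer_def vec_eq_iff algebra_simps)
    then have "(\<sigma> has_derivative (\<lambda>v. 0 + outer v p)) (at u)"
      unfolding \<sigma>_def by (intro has_derivative_add has_derivative_const bounded_linear_imp_has_derivative)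
    from frechet_derivative_at[OF this] show ?thesis by simp
  qed
  have eqI: "x = y" if "x *v p = y *v p" "x *v q = y *v q" for x y :: point
    by (rule mv_basis_eqI[OF that q(2)])
  have \<sigma>p: "\<sigma> u *v p = w" for u
    by (simp add: \<sigma>_def matrix_vector_mult_add_rdistrib outer_mv x0w)
  have g\<sigma>: "g (\<sigma> u) = u" for u
    using q(1) by (simp add: g_def \<sigma>_def outer_mv vector_smult_assoc)
  have \<sigma>g: "\<sigma> (g x) = x" if "x \<in> alpha_plane p w" for x
  proof (rule eqI)
    show "\<sigma> (g x) *v p = x *v p" using that by (simp add: \<sigma>p alpha_plane_def)
    show "\<sigma> (g x) *v q = x *v q"
      using q(1) by (simp add: \<sigma>_def g_def matrix_vector_mult_add_rdistrib outer_mv vector_smult_assoc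
          matrix_vector_mult_diff_rdistrib)
  qed
  have U: "open U"
    unfolding U_def by (rule open_vimage[OF T(1) holo_on_imp_continuous_on[OF holo\<sigma>[OF open_UNIV]]])
  have im: "\<sigma> ` U = S"
    using \<sigma>g \<sigma>p T(2) by (auto simp: U_def alpha_plane_def image_iff) (metis vimageI2)
  have contg: "continuous_on A g" for A
  proof -
    have "continuous_on A (\<lambda>x. \<chi> i. 1 / contract q p * ((x - x0) *v q) $ i)"
      by (intro continuous_intros continuous_on_mv)
    then show ?thesis by (simp add: g_def[abs_def] vector_scalar_mult_def)
  qed
  have injD: "inj (frechet_derivative \<sigma> (at u))" for u
  proof (rule injI)
    fix a b assume "frechet_derivative \<sigma> (at u) a = frechet_derivative \<sigma> (at u) b"
    then have "outer a p *v q = outer b p *v q" by (simp add: D\<sigma>)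
    then show "a = b" using q(1) by (simp add: outer_mv vector_mul_lcancel)
  qed
  have "homeomorphism U (\<sigma> ` U) \<sigma> g"
    unfolding homeomorphism_def
    using holo_on_imp_continuous_on[OF holo\<sigma>[OF U]] contg by (auto simp: g\<sigma> image_image)
  then have chart: "surface_chart S U \<sigma>"
    unfolding surface_chart_def using holo\<sigma>[OF U] injD im by blast
  then have emb: "embedded_surface S"
    unfolding embedded_surface_def using S(2,3) im by blast
  show tan: "tangent_plane S x = alpha_directions p" if x: "x \<in> S" for x
  proof (intro set_eqI iffI)
    fix v assume "v \<in> tangent_plane S x"
    then obtain U' \<sigma>' u where c: "surface_chart S U' \<sigma>'" "u \<in> U'"
      "v \<in> range (frechet_derivative \<sigma>' (at u))"
      unfolding tangent_plane_def by blast
    have "\<sigma>' ` U' \<subseteq> S" "holo_on \<sigma>' U'" using c(1) by (auto simp: surface_chart_def)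
    then have "frechet_derivative \<sigma>' (at u) a *v p = 0" for a
      using T(2) c(2) by (intro derivative_in_alpha_directions[of _ U' _ w]) (auto simp: alpha_plane_def)
    then show "v \<in> alpha_directions p" using c(3) by (auto simp: alpha_directions_def)
  next
    fix v assume "v \<in> alpha_directions p"
    then have "v *v p = 0" by (simp add: alpha_directions_def)
    then have "v = outer ((1 / contract q p) *s (v *v q)) p"
      using q(1) by (intro eqI) (simp_all add: outer_mv vector_smult_assoc)
    then have "v \<in> range (frechet_derivative \<sigma> (at u))" for u unfolding D\<sigma> by (rule range_eqI)
    moreover obtain u where "u \<in> U" "\<sigma> u = x" using x im by auto
    ultimately show "v \<in> tangent_plane S x"
      unfolding tangent_plane_def using chart
      by (intro CollectI exI[of _ U] exI[of _ \<sigma>] exI[of _ u] conjI)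
  qed
  show "self_dual_surface S" unfolding self_dual_surface_def using emb tan p by blast
qed

text \<open>In the affine coordinates \<open>w = x p\<close> and \<open>y = x q\<close> the surface is locally a graph
  \<open>w = \<phi> y\<close>, and a tangent \<open>\<alpha>\<close>-plane with spinor \<open>a p + b q\<close> forces \<open>a d\<phi> = - b id\<close>.\<close>

lemma chart_locally_in_alpha_plane:
  fixes \<sigma> :: "complex^2 \<Rightarrow> point"
  assumes hol: "holo_on \<sigma> U"
    and inj: "\<And>u. u \<in> U \<Longrightarrow> inj (frechet_derivative \<sigma> (at u))"
    and null: "\<And>u. u \<in> U \<Longrightarrow> \<exists>p. p \<noteq> 0 \<and> (\<forall>v. frechet_derivative \<sigma> (at u) v *v p = 0)"
    and u0: "u0 \<in> U" and p: "p \<noteq> 0" "\<And>v. frechet_derivative \<sigma> (at u0) v *v p = 0"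
  obtains U' where "open U'" "u0 \<in> U'" "U' \<subseteq> U" "\<And>u. u \<in> U' \<Longrightarrow> \<sigma> u *v p = \<sigma> u0 *v p"
proof -
  obtain q where q: "contract p q \<noteq> 0" using p(1) by (rule exists_contract_nonzero)
  let ?D = "\<lambda>u. frechet_derivative \<sigma> (at u)"
  define Y where "Y u = \<sigma> u *v q" for u
  have Y: "holo_on Y U" unfolding Y_def by (rule holo_on_mv[OF hol])
  have DY: "frechet_derivative Y (at u) v = ?D u v *v q" if "u \<in> U" for u v
    unfolding Y_def by (simp add: frechet_derivative_mv[OF hol that])
  define Y' where "Y' u = Blinfun (frechet_derivative Y (at u))" for u
  have Y': "blinfun_apply (Y' u) = frechet_derivative Y (at u)" if "u \<in> U" for u
    unfolding Y'_def
    by (rule bounded_linear_Blinfun_apply[OF holo_on_has_derivative_bounded_linear[OF Y that]])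
  have contY': "continuous_on U Y'"
  proof (rule continuous_on_blinfun_componentwise)
    fix i :: "complex^2"
    show "continuous_on U (\<lambda>u. blinfun_apply (Y' u) i)"
      by (rule continuous_on_eq[OF holo_on_derivative_continuous[OF Y, of i]]) (simp add: Y')
  qed
  let ?L = "frechet_derivative Y (at u0)"
  have linL: "linear ?L"
    using holo_on_has_derivative_bounded_linear[OF Y u0] bounded_linear.linear by blast
  \<comment> \<open>Tangent vectors at \<open>u0\<close> annihilate \<open>p\<close>, hence are
    determined by their contraction with \<open>q\<close>; this makes \<open>Y\<close> a local
    coordinate.\<close>
  have "inj ?L"
  proof (rule injI)
    fix a b assume "?L a = ?L b"
    then have "?D u0 a *v q = ?D u0 b *v q" by (simp add: DY[OF u0])
    then have "?D u0 a = ?D u0 b" using p(2) by (intro mv_basis_eqI[OF _ _ q]) simp_all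
    then show "a = b" using inj[OF u0] by (simp add: inj_eq)
  qed
  then obtain L' where L': "linear L'" "L' \<circ> ?L = id"
    using linear_injective_left_inverse[OF linL] by blast
  have "blinfun_apply (Blinfun L') = L'"
    using L'(1) by (simp add: bounded_linear_Blinfun_apply linear_conv_bounded_linear)
  then have inv: "Blinfun L' o\<^sub>L Y' u0 = id_blinfun"
    using L'(2) by (intro blinfun_eqI) (simp add: Y'[OF u0] fun_eq_iff)
  have dY: "(Y has_derivative blinfun_apply (Y' u)) (at u)" if "u \<in> U" for u
    using holo_on_derivative(1)[OF Y that] by (simp add: Y'[OF that])
  obtain U1 V g g' where ift: "open U1" "U1 \<subseteq> U" "u0 \<in> U1" "open V" "Y u0 \<in> V" "homeomorphism U1 V Y g"
    "\<And>y. y \<in> V \<Longrightarrow> (g has_derivative g' y) (at y)"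
    "\<And>y. y \<in> V \<Longrightarrow> g' y = inv (blinfun_apply (Y' (g y)))"
    "\<And>y. y \<in> V \<Longrightarrow> bij (blinfun_apply (Y' (g y)))"
    using inverse_function_theorem[OF holo_on_open[OF hol] dY contY' u0 inv] by blast
  have gU: "g y \<in> U" if "y \<in> V" for y
    using ift(2,6) that by (auto simp: homeomorphism_def)
  define \<phi> where "\<phi> y = \<sigma> (g y) *v p" for y
  have d\<phi>: "(\<phi> has_derivative (\<lambda>v. ?D (g y) (g' y v) *v p)) (at y)" if "y \<in> V" for y
    unfolding \<phi>_def
    by (rule bounded_linear.has_derivative[OF bounded_linear_mv
          has_derivative_compose[OF ift(7)[OF that] holo_on_derivative(1)[OF hol gU[OF that]]]])
  have "\<exists>m. (\<phi> has_derivative (\<lambda>v. m *s v)) (at y)" if y: "y \<in> V" for y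
  proof -
    let ?\<eta> = "\<lambda>v. ?D (g y) (g' y v)"
    have \<eta>q: "?\<eta> v *v q = v" for v
    proof -
      have "frechet_derivative Y (at (g y)) (g' y v) = v"
        using ift(8,9)[OF y] Y'[OF gU[OF y]] by (metis bij_is_surj surj_f_inv_f)
      then show ?thesis by (simp add: DY[OF gU[OF y]])
    qed
    obtain r where r: "r \<noteq> 0" "\<And>v. ?D (g y) v *v r = 0" using null[OF gU[OF y]] by blast
    obtain a b where ab: "r = a *s p + b *s q" using spinor_expand[OF q] by blast
    have rel: "a *s (?\<eta> v *v p) + b *s v = 0" for v
      using r(2)[of "g' y v"] \<eta>q[of v]
      by (simp add: ab matrix_vector_right_distrib mv_smult)
    have "a \<noteq> 0"
    proof
      assume "a = 0"
      then have "b = 0" using rel[of "axis 1 1"] by (simp add: axis_eq_0_iff)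
      then show False using r(1) ab \<open>a = 0\<close> by simp
    qed
    have "?\<eta> v *v p = (- b / a) *s v" for v
    proof -
      have "a * (?\<eta> v *v p) $ i + b * v $ i = 0" for i
        using arg_cong[OF rel[of v], of "\<lambda>x. x $ i"] by simp
      then show ?thesis using \<open>a \<noteq> 0\<close> by (simp add: vec_eq_iff field_simps eq_neg_iff_add_eq_0)
    qed
    then have "(\<lambda>v. ?\<eta> v *v p) = (\<lambda>v. (- b / a) *s v)" by (rule ext)
    then have "(\<phi> has_derivative (\<lambda>v. (- b / a) *s v)) (at y)" using d\<phi>[OF y] by (simp only:)
    then show ?thesis by (rule exI)
  qed
  then obtain m where m: "\<And>y. y \<in> V \<Longrightarrow> (\<phi> has_derivative (\<lambda>v. m y *s v)) (at y)" by metis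
  have gY: "g (Y u) = u" if "u \<in> U1" for u using ift(6) that by (simp add: homeomorphism_def)
  \<comment> \<open>At \<open>u0\<close> the tangent spinor is \<open>p\<close> itself, so the
    derivative of \<phi> vanishes there. This initial value forces \<phi> to be constant
    nearby.\<close>
  have "(\<lambda>v. m (Y u0) *s v) = (\<lambda>v :: spinor. 0)"
    using has_derivative_unique[OF m[OF ift(5)] d\<phi>[OF ift(5)]] p(2) by (simp add: gY[OF ift(3)])
  then have "m (Y u0) *s axis 1 1 = (0 :: spinor)" by metis
  then have m0: "m (Y u0) = 0" by (simp add: axis_eq_0_iff)
  obtain r where r: "r > 0" "\<And>y. y \<in> ball (Y u0) r \<Longrightarrow> \<phi> y = \<phi> (Y u0)"
    using homothetic_derivative_locally_constant[OF ift(4,5) m m0] by blast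
  show ?thesis
  proof (rule that[of "U1 \<inter> Y -` ball (Y u0) r"])
    show "open (U1 \<inter> Y -` ball (Y u0) r)"
      using ift(1,2) continuous_on_subset[OF holo_on_imp_continuous_on[OF Y]]
      by (intro continuous_open_preimage) auto
    show "\<sigma> u *v p = \<sigma> u0 *v p" if "u \<in> U1 \<inter> Y -` ball (Y u0) r" for u
      using r(2)[of "Y u"] that by (simp add: \<phi>_def gY ift(3))
  qed (use ift(2,3) r(1) in auto)
qed

section \<open>From charts to the whole self-dual surface\<close>

text \<open>A small piece of a chart lies in one alpha-plane and is open there by invariance of
  domain. It is also open in \<open>S\<close>, as the connectedness argument requires.\<close>

lemma self_dual_surface_locally:
  assumes S: "self_dual_surface S" and x: "x \<in> S" and p: "p \<noteq> 0" "tangent_plane S x = alpha_directions p"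
  obtains N where "openin (top_of_set S) N" "x \<in> N"
    "openin (top_of_set (alpha_plane p (x *v p))) N"
    "\<forall>y\<in>N. tangent_plane S y = alpha_directions p"
proof -
  obtain U \<sigma> where c0: "surface_chart S U \<sigma>" "x \<in> \<sigma> ` U"
    using S x unfolding self_dual_surface_def embedded_surface_def by blast
  then obtain u0 where c: "surface_chart S U \<sigma>" "u0 \<in> U" "\<sigma> u0 = x" by auto
  let ?D = "\<lambda>u. frechet_derivative \<sigma> (at u)"
  obtain h W where ch: "holo_on \<sigma> U" "\<And>u. u \<in> U \<Longrightarrow> inj (?D u)" "homeomorphism U (\<sigma> ` U) \<sigma> h"
    "open W" "\<sigma> ` U = S \<inter> W"
    using c(1) unfolding surface_chart_def by blast
  have tan: "?D u v \<in> tangent_plane S (\<sigma> u)" if "u \<in> U" for u v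
    using c(1) that unfolding tangent_plane_def by blast
  have sd: "\<exists>r. r \<noteq> 0 \<and> tangent_plane S (\<sigma> u) = alpha_directions r" if "u \<in> U" for u
    using S ch(5) that unfolding self_dual_surface_def by blast
  have null: "\<exists>r. r \<noteq> 0 \<and> (\<forall>v. ?D u v *v r = 0)" if "u \<in> U" for u
    using sd[OF that] tan[OF that] by (auto simp: alpha_directions_def)
  have Dp: "?D u0 v *v p = 0" for v
    using tan[OF c(2)] p(2) c(3) by (auto simp: alpha_directions_def)
  obtain U' where U': "open U'" "u0 \<in> U'" "U' \<subseteq> U" "\<And>u. u \<in> U' \<Longrightarrow> \<sigma> u *v p = \<sigma> u0 *v p"
    using chart_locally_in_alpha_plane[OF ch(1,2) null c(2) p(1) Dp] by blast
  have hol': "holo_on \<sigma> U'" using holo_on_subset[OF ch(1) U'(1,3)] .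
  show ?thesis
  proof (rule that[of "\<sigma> ` U'"])
    have "openin (top_of_set (\<sigma> ` U)) (\<sigma> ` U')"
      using U'(1,3) homeomorphism_imp_open_map[OF ch(3)] by (simp add: open_subset)
    moreover have "openin (top_of_set S) (\<sigma> ` U)" using ch(4,5) by (auto simp: openin_open)
    ultimately show "openin (top_of_set S) (\<sigma> ` U')" by (rule openin_trans)
    show "x \<in> \<sigma> ` U'" using U'(2) c(3) by blast
    have "h (\<sigma> u) = u" if "u \<in> U'" for u
      using homeomorphism_apply1[OF ch(3)] U'(3) that by blast
    then have "inj_on \<sigma> U'" by (rule inj_on_inverseI)
    then show "openin (top_of_set (alpha_plane p (x *v p))) (\<sigma> ` U')"
      using U'(4) c(3)
      by (intro plane_invariance_of_domain U'(1) p(1) holo_on_imp_continuous_on[OF hol'])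
         (auto simp: alpha_plane_def)
    show "\<forall>y\<in>\<sigma> ` U'. tangent_plane S y = alpha_directions p"
    proof
      fix y assume y: "y \<in> \<sigma> ` U'"
      obtain u where u: "u \<in> U'" "y = \<sigma> u" using y by blast
      then have uU: "u \<in> U" using U'(3) by blast
      obtain r where r: "r \<noteq> 0" "tangent_plane S (\<sigma> u) = alpha_directions r" using sd[OF uU] by blast
      have "?D u v *v r = 0" "?D u v *v p = 0" for v
        using tan[OF uU] r(2) derivative_in_alpha_directions[OF hol' U'(4) u(1)]
        by (auto simp: alpha_directions_def)
      \<comment> \<open>Were \<open>r\<close> independent of \<open>p\<close>, the derivative of the
        chart, whose values annihilate both, would be zero, against its injectivity.\<close>
      then have "?D u v = 0" if "contract p r \<noteq> 0" for v
        using mv_basis_eqI[of "?D u v" p 0 r] that by simp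
      moreover have "?D u (axis 1 1) \<noteq> ?D u 0"
        using ch(2)[OF uU] by (simp add: inj_eq axis_eq_0_iff)
      ultimately have "contract p r = 0" by metis
      then obtain k where "r = k *s p" by (rule contract_eq_0_imp_scale[OF p(1)])
      moreover from this have "k \<noteq> 0" using r(1) by auto
      ultimately show "tangent_plane S y = alpha_directions p"
        using r(2) u(2) alpha_directions_scale by simp
    qed
  qed
qed

text \<open>Local constancy and connectedness give a common tangent spinor \<open>p\<close>. Only
  with \<open>p\<close> the same everywhere can the values x p be compared, and the same argument
  makes them constant.\<close>

lemma self_dual_surface_alpha_plane:
  assumes S: "self_dual_surface S"
  obtains p w where "p \<noteq> 0" "openin (top_of_set (alpha_plane p w)) S" "S \<noteq> {}" "connected S"
    "\<And>x. x \<in> S \<Longrightarrow> tangent_alpha S x = proj p"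
proof -
  have ne: "S \<noteq> {}" "connected S" using S by (auto simp: self_dual_surface_def embedded_surface_def)
  have ev: "eventually (\<lambda>y. f x = f y) (at x within S)"
    if "openin (top_of_set S) N" "x \<in> N" "\<And>y. y \<in> N \<Longrightarrow> f y = f x" for f :: "point \<Rightarrow> 'b" and N x
  proof -
    have "\<exists>T. open T \<and> N = S \<inter> T" using that(1) by (simp only: openin_open)
    then obtain T where "open T" "N = S \<inter> T" by blast
    moreover from this have "x \<in> T" using that(2) by simp
    moreover have "f x = f y" if "y \<in> S \<inter> T" for y
      using \<open>N = S \<inter> T\<close> that by (intro \<open>\<And>y. y \<in> N \<Longrightarrow> f y = f x\<close>[symmetric]) simp
    ultimately show ?thesis unfolding eventually_at_topological by blast
  qed
  obtain x0 where x0: "x0 \<in> S" using ne by blast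
  obtain p where p: "p \<noteq> 0" "tangent_plane S x0 = alpha_directions p"
    using S x0 unfolding self_dual_surface_def by blast
  have "tangent_plane S x0 = tangent_plane S x" if x: "x \<in> S" for x
  proof (rule connected_local_const[OF ne(2) x0 x], rule ballI)
    fix y assume y: "y \<in> S"
    obtain r where r: "r \<noteq> 0" "tangent_plane S y = alpha_directions r"
      using S y unfolding self_dual_surface_def by blast
    obtain N where N: "openin (top_of_set S) N" "y \<in> N"
      "openin (top_of_set (alpha_plane r (y *v r))) N"
      "\<forall>z\<in>N. tangent_plane S z = alpha_directions r"
      by (rule self_dual_surface_locally[OF S y r])
    show "eventually (\<lambda>z. tangent_plane S y = tangent_plane S z) (at y within S)"
      using N(4) r(2) by (intro ev[OF N(1,2)]) metis
  qed
  then have tan: "tangent_plane S x = alpha_directions p" if "x \<in> S" for x using that p(2) by metis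
  have con: "x0 *v p = x *v p" if x: "x \<in> S" for x
  proof (rule connected_local_const[OF ne(2) x0 x], rule ballI)
    fix y assume y: "y \<in> S"
    obtain N where N: "openin (top_of_set S) N" "y \<in> N" "openin (top_of_set (alpha_plane p (y *v p))) N"
      by (rule self_dual_surface_locally[OF S y p(1) tan[OF y]])
    have "z *v p = y *v p" if "z \<in> N" for z
      using that openin_imp_subset[OF N(3)] by (auto simp: alpha_plane_def)
    then show "eventually (\<lambda>z. y *v p = z *v p) (at y within S)"
      by (rule ev[OF N(1,2)])
  qed
  have "openin (top_of_set (alpha_plane p (x0 *v p))) S"
    unfolding openin_subopen[of _ S]
  proof
    fix y assume y: "y \<in> S"
    obtain N where "openin (top_of_set S) N" "y \<in> N" "openin (top_of_set (alpha_plane p (y *v p))) N"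
      by (rule self_dual_surface_locally[OF S y p(1) tan[OF y]])
    then show "\<exists>N. openin (top_of_set (alpha_plane p (x0 *v p))) N \<and> y \<in> N \<and> N \<subseteq> S"
      using con[OF y] openin_imp_subset by metis
  qed
  moreover have "tangent_alpha S x = proj p" if "x \<in> S" for x
    by (rule tangent_alpha_eq[OF p(1) tan[OF that]])
  ultimately show ?thesis using that p(1) ne by blast
qed

section \<open>Images of self-dual surfaces\<close>

context twistor_endomorphism
begin

text \<open>If the image points agree, DF(z) sends the twistors incident with \<open>x\<close> and
  those incident with \<open>y\<close> into one two-dimensional space. Injectivity, with F(z) =
  DF(z)(z / d) from Euler's identity, then gives \<open>x\<close> and \<open>y\<close> a second
  common twistor besides \<open>z\<close>, and two such twistors fix the point.\<close>

lemma image_point_inject: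
  assumes "x *v p = y *v p" "wronskian x p q \<noteq> 0" "wronskian y p q \<noteq> 0"
    and "jacobian (twistor_at x p) \<noteq> 0" "image_point x p q = image_point y p q"
  shows "x = y"
proof -
  define z where "z = twistor_at x p"
  have zy: "twistor_at y p = z" using assms(1) by (simp add: z_def twistor_eq_iff)
  define a b where "a = DF z (twistor_at x q)" and "b = DF z (twistor_at y q)"
  define Z where "Z = image_point x p q"
  note ia = incident_image_point[OF assms(2), folded z_def Z_def]
  note ib = incident_image_point[OF assms(3), unfolded zy, folded assms(5), folded Z_def]
  have inc: "incident Z (F z)" "incident Z a" "incident Z b"
    using ia ib by (simp_all add: a_def b_def)
  have nz: "contract (primed (F z)) (primed a) \<noteq> 0"
    using assms(2) by (simp add: wronskian_def z_def a_def)
  obtain s t where "primed b = s *s primed (F z) + t *s primed a"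
    using spinor_expand[OF nz] by blast
  then have "b = s *s F z + t *s a"
    using inc by (metis incident_iff twistor_at_add twistor_at_scale)
  moreover have "F z = DF z ((1 / of_nat d) *s z)"
    using d_pos by (simp add: DF_scale Euler vector_smult_assoc)
  ultimately have "DF z (twistor_at y q) = DF z (s *s ((1 / of_nat d) *s z) + t *s twistor_at x q)"
    by (simp add: a_def b_def DF_add DF_scale)
  then have eq: "twistor_at y q = (s / of_nat d) *s z + t *s twistor_at x q"
    using assms(4) by (simp add: inj_DF_iff[symmetric] z_def inj_eq vector_smult_assoc)
  have cpq: "contract p q \<noteq> 0" by (rule wronskian_nonzero_imp(1)[OF assms(2)])
  \<comment> \<open>Both twistors have primed part \<open>q\<close>, so comparison in the basis
    \<open>p\<close>, \<open>q\<close> makes the coefficient of \<open>p\<close> zero and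
    \<open>t\<close> equal to 1.\<close>
  have pq: "q = (s / of_nat d) *s p + t *s q"
    using arg_cong[OF eq, of primed] by (simp add: primed_add primed_scale z_def)
  have "contract p q = t * contract p q"
    using arg_cong[OF pq, of "contract p"] by (simp add: contract_add_right contract_scale_right)
  then have t: "t = 1" using cpq by simp
  have "contract q q = (s / of_nat d) * contract p q"
    using arg_cong[OF pq, of "\<lambda>r. contract r q"] by (simp add: contract_add_left contract_scale_left)
  then have "s / of_nat d = 0" using cpq by simp
  then have "twistor_at y q = twistor_at x q" using eq t by (simp only: vector_smult_lzero add_0 vector_smult_lid)
  then have "omega (twistor_at y q) = omega (twistor_at x q)" by simp
  then have "x *v q = y *v q" by (simp add: vector_mul_lcancel)
  then show ?thesis by (rule mv_basis_eqI[OF assms(1) _ cpq])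
qed

text \<open>It suffices that the image is a nonempty connected open subset of an alpha-plane:
  \<open>alpha_plane_surface\<close> then supplies a chart and the tangent planes, and the charts of
  \<open>S\<close> serve only to show openness.\<close>

lemma self_dual_image:
  assumes "surface_in (regular_region F ft) S"
  defines "f \<equiv> \<lambda>x. fst (corr_map (x, tangent_alpha S x))"
  shows "self_dual_surface (f ` S)"
    and "\<And>x. x \<in> S \<Longrightarrow> tangent_alpha (f ` S) (f x) = snd (corr_map (x, tangent_alpha S x))"
proof -
  have S: "self_dual_surface S" "surface_lift S \<subseteq> regular_region F ft"
    using assms(1) by (simp_all add: surface_in_def)
  obtain p w where p: "p \<noteq> 0" "openin (top_of_set (alpha_plane p w)) S" "S \<noteq> {}" "connected S"
    "\<And>x. x \<in> S \<Longrightarrow> tangent_alpha S x = proj p"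
    using self_dual_surface_alpha_plane[OF S(1)] by blast
  obtain q where q: "contract p q \<noteq> 0" using p(1) by (rule exists_contract_nonzero)
  have Sw: "x *v p = w" if "x \<in> S" for x
    using p(2) openin_imp_subset that by (fastforce simp: alpha_plane_def)
  \<comment> \<open>The tangent spinor is constant along the surface, so one \<open>q\<close>
    independent of it serves for every point.\<close>
  have reg: "wronskian x p q \<noteq> 0" "jacobian (twistor_at x p) \<noteq> 0" if x: "x \<in> S" for x
  proof -
    have "(x, proj p) \<in> regular_region F ft"
      using S(2) p(5)[OF x] x by (auto simp: surface_lift_def)
    then have *: "(x, p) \<in> nonsingular_set" "jacobian (twistor_at x p) \<noteq> 0"
      using mem_regular_region[OF p(1)] by auto
    then show "wronskian x p q \<noteq> 0" "jacobian (twistor_at x p) \<noteq> 0"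
      using wronskian_nonzero_transfer[OF _ q] by (auto simp: nonsingular_set_def)
  qed
  obtain x0 where x0: "x0 \<in> S" using p(3) by blast
  define z where "z = twistor_at x0 p"
  have z: "twistor_at x p = z" if "x \<in> S" for x
    using Sw[OF that] Sw[OF x0] by (simp add: z_def twistor_eq_iff)
  define P where "P = primed (F z)"
  have P: "P \<noteq> 0" using wronskian_nonzero_imp(3)[OF reg(1)[OF x0]] by (simp add: P_def z_def)
  have corr: "corr_map (x, tangent_alpha S x) = (image_point x p q, proj P)" if "x \<in> S" for x
    using corr_map_eq[OF reg(1)[OF that]] z[OF that] by (simp add: p(5)[OF that] P_def)
  have f: "f x = image_point x p q" if "x \<in> S" for x by (simp add: f_def corr[OF that])
  have inj: "inj_on f S"
    using image_point_inject Sw reg by (intro inj_onI) (metis f)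
  have "continuous_on S (\<lambda>x. image_point (fst (x, p)) (snd (x, p)) q)"
    by (rule continuous_on_compose2[OF holo_on_imp_continuous_on[OF holo_image_point]])
       (auto intro!: continuous_intros simp: reg)
  then have cont: "continuous_on S f" by (rule continuous_on_eq) (simp add: f)
  \<comment> \<open>All points of \<open>S\<close> share the twistor \<open>z\<close>, so all image
    points are incident with F(z); dividing its \<open>omega\<close> part by i gives the constant
    value of f(x) P.\<close>
  define w' where "w' = (1 / \<i>) *s omega (F z)"
  have fw: "f x *v P = w'" if "x \<in> S" for x
  proof -
    have "omega (F z) = \<i> *s (f x *v P)"
      using incident_image_point(1)[OF reg(1)[OF that]] z[OF that]
      by (simp add: f[OF that] incident_def P_def)
    then show ?thesis by (simp add: w'_def vector_smult_assoc)
  qed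
  have "openin (top_of_set (alpha_plane P w')) (f ` S)"
    unfolding openin_subopen[of _ "f ` S"]
  proof
    fix y assume "y \<in> f ` S"
    then obtain x where x: "x \<in> S" "y = f x" by blast
    obtain U \<sigma> where c: "surface_chart S U \<sigma>" "x \<in> \<sigma> ` U"
      using S(1) x(1) unfolding self_dual_surface_def embedded_surface_def by blast
    obtain h where ch: "holo_on \<sigma> U" "homeomorphism U (\<sigma> ` U) \<sigma> h" "\<sigma> ` U \<subseteq> S"
      using c(1) unfolding surface_chart_def by blast
    have "continuous_on U (\<lambda>u. f (\<sigma> u))"
      by (rule continuous_on_compose2[OF cont holo_on_imp_continuous_on[OF ch(1)] ch(3)])
    moreover have "inj_on (\<lambda>u. f (\<sigma> u)) U"
    proof (rule comp_inj_on[of \<sigma> U f, unfolded comp_def])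
      show "inj_on \<sigma> U" by (rule inj_on_inverseI[of _ h]) (rule homeomorphism_apply1[OF ch(2)])
      show "inj_on f (\<sigma> ` U)" by (rule inj_on_subset[OF inj ch(3)])
    qed
    ultimately have "openin (top_of_set (alpha_plane P w')) ((\<lambda>u. f (\<sigma> u)) ` U)"
      using ch(3) fw
      by (intro plane_invariance_of_domain[OF holo_on_open[OF ch(1)] _ _ P]) (auto simp: alpha_plane_def)
    then show "\<exists>T. openin (top_of_set (alpha_plane P w')) T \<and> y \<in> T \<and> T \<subseteq> f ` S"
      using x(2) c(2) ch(3) by (intro exI[of _ "(\<lambda>u. f (\<sigma> u)) ` U"]) auto
  qed
  moreover have "connected (f ` S)" by (rule connected_continuous_image[OF cont p(4)])
  ultimately have *: "openin (top_of_set (alpha_plane P w')) (f ` S)" "f ` S \<noteq> {}" "connected (f ` S)"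
    using p(3) by auto
  show "self_dual_surface (f ` S)" by (rule alpha_plane_surface(1)[OF P *])
  show "tangent_alpha (f ` S) (f x) = snd (corr_map (x, tangent_alpha S x))" if x: "x \<in> S" for x
    using tangent_alpha_eq[OF P alpha_plane_surface(2)[OF P *]] x by (simp add: corr)
qed

end

text \<open>Surfaces are carried by lifting, applying \<open>corr_map\<close> and projecting.
  Locality is immediate, as the value is a function of the lifted point; the substance is that the
  image is a self-dual surface whose tangent alpha-plane is the second component of
  \<open>corr_map\<close>.\<close>

theorem theorem1:
  fixes d :: nat and F :: "twistor \<Rightarrow> twistor" and ft :: "CP3 \<Rightarrow> CP3"
  assumes "proj_endomorphism d F ft"
  shows "\<exists>f1 :: corr \<Rightarrow> corr.
      open (nonsingular_region ft) \<and> closure (nonsingular_region ft) = UNIV \<and>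
      corr_holo_on f1 (nonsingular_region ft) \<and> arises_from f1 ft \<and>
      open (regular_region F ft) \<and> closure (regular_region F ft) = UNIV \<and>
      (\<exists>\<Phi>. self_dual_morphism (regular_region F ft) \<Phi> \<and>
            tangent_consistent (regular_region F ft) f1 \<Phi>)"
proof -
  interpret twistor_endomorphism d F ft by unfold_locales (rule assms)
  let ?W = "regular_region F ft"
  define \<Phi> where "\<Phi> S x = fst (corr_map (x, tangent_alpha S x))" for S x
  have image: "self_dual_surface (\<Phi> S ` S)" if "surface_in ?W S" for S
    using self_dual_image(1)[OF that] by (simp add: \<Phi>_def)
  have tangent: "tangent_alpha (\<Phi> S ` S) (\<Phi> S x) = snd (corr_map (x, tangent_alpha S x))"
    if "surface_in ?W S" "x \<in> S" for S x
    using self_dual_image(2)[OF that] by (simp add: \<Phi>_def)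
  have holo: "corr_holo_on corr_map ?W"
    by (rule corr_holo_corr_map[OF open_regular_region]) (simp add: mem_regular_region)
  have "self_dual_morphism ?W \<Phi>"
    unfolding self_dual_morphism_def
  proof (intro conjI allI impI)
    fix S T x
    assume "surface_in ?W S \<and> surface_in ?W T \<and> x \<in> S \<inter> T \<and> tangent_alpha S x = tangent_alpha T x"
    then have S: "surface_in ?W S" "x \<in> S" and T: "surface_in ?W T" "x \<in> T"
      and eq: "tangent_alpha S x = tangent_alpha T x" by auto
    show "\<Phi> S x = \<Phi> T x" by (simp add: \<Phi>_def eq)
    show "tangent_alpha (\<Phi> S ` S) (\<Phi> S x) = tangent_alpha (\<Phi> T ` T) (\<Phi> T x)"
      by (simp only: tangent[OF S] tangent[OF T] eq)
  next
    show "\<exists>g. corr_holo_on g ?W \<and> (\<forall>S x. surface_in ?W S \<and> x \<in> S \<longrightarrow>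
        (\<Phi> S x, tangent_alpha (\<Phi> S ` S) (\<Phi> S x)) = g (x, tangent_alpha S x))"
      using holo tangent by (intro exI[of _ corr_map]) (simp add: \<Phi>_def)
  qed (rule image)
  moreover have "tangent_consistent ?W corr_map \<Phi>"
    unfolding tangent_consistent_def using tangent by (simp add: \<Phi>_def)
  moreover have "corr_holo_on corr_map (nonsingular_region ft)"
    by (rule corr_holo_corr_map[OF open_nonsingular_region]) (simp add: mem_nonsingular_region)
  ultimately show ?thesis
    using open_nonsingular_region closure_nonsingular_region arises_from_corr_map
      open_regular_region closure_regular_region by blast
qed

end
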